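(* Let $H$ be a complex Hilbert space and let $T\in\mathcal{B}(H)$ with $\sigma(T)\subset\mathbb{D}\cup\{1\}$. Let $\gamma:[-\delta_-,\delta_+]\to\mathbb{C}$ be a v-type curve, and set $r(\theta)=|\gamma(\theta)|$. Assume that $T$ satisfies the Kreiss condition. Assume moreover that $\nu\ge r(\delta_+)-1$ and that $\varepsilon:(0,\nu]\to(0,\infty)$ is a continuous increasing function with $\varepsilon(0^+)=0$ such that the resolvent estimate $$\|(\lambda-T)^{-1}\|\le\frac{1+\varepsilon(|\lambda|-1)}{|\lambda|-1}$$ holds for all $\lambda\ne 1$ in the set determined by $\gamma$. If $$\int_{-\delta_-}^{\delta_+}\frac{\varepsilon(r(\theta)-1)}{r(\theta)-1}\,\big\|(e^{-i\theta}-T)^{-1}\big\|^2\,d\theta<\infty,$$ then $T$ is similar to a contraction.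
   Context: $\mathbb{D}$ is the open unit disk. $\varepsilon(0^+)=\lim_{x\to0^+}\varepsilon(x)$. Kreiss condition: there is a constant $C$ such that $\|(\lambda-T)^{-1}\|\le C/(|\lambda|-1)$ for all $|\lambda|>1$. v-type curve: let $\delta_-,\delta_+\in(0,\pi)$, let $r:[-\delta_-,\delta_+]\to[1,+\infty)$ be continuous and $\gamma(\theta)=r(\theta)e^{-i\theta}$ for $\theta\in[-\delta_-,\delta_+]$. The curve $\gamma$ is a v-type curve if (a) $r$ strictly increases on $[0,\delta_+]$ and strictly decreases on $[-\delta_-,0]$; (b) $r(0)=1$ and $r(-\delta_-)=r(\delta_+)>1$; (c) $\int_{-\delta_-}^{\delta_+}\frac{1}{r(\theta)-1}\,d\theta<\infty$. The set determined by the v-type curve $\gamma$ is the closed domain bordered by the Jordan curve that is the union of $\gamma$ and the arc $\{r(\delta_+)e^{-i\theta}:-\delta_-\le\theta\le\delta_+\}$; that is, the set $\{\rho e^{-i\theta}:-\delta_-\le\theta\le\delta_+,\ r(\theta)\le\rho\le r(\delta_+)\}$. $T$ is similar to a contraction if there is a bounded invertible operator $S$ on $H$ with $\|STS^{-1}\|\le1$. *)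

theory Defs
  imports "HOL-Analysis.Analysis"
begin

text \<open>
  The distribution has real inner product spaces only.  The inner product below is linear in
  its first argument, and it induces the norm; together with the norm axioms the axiom
  \<open>cinner_self\<close> gives positive definiteness.
\<close>

class complex_inner = real_normed_vector +
  fixes scaleC :: "complex \<Rightarrow> 'a \<Rightarrow> 'a"  (infixr \<open>*\<^sub>C\<close> 75)
    and cinner :: "'a \<Rightarrow> 'a \<Rightarrow> complex"
  assumes scaleC_add_right: "a *\<^sub>C (x + y) = a *\<^sub>C x + a *\<^sub>C y"
    and scaleC_add_left: "(a + b) *\<^sub>C x = a *\<^sub>C x + b *\<^sub>C x"
    and scaleC_scaleC: "a *\<^sub>C b *\<^sub>C x = (a * b) *\<^sub>C x"
    and scaleC_of_real: "complex_of_real t *\<^sub>C x = t *\<^sub>R x"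
    and cinner_commute: "cinner x y = cnj (cinner y x)"
    and cinner_add_left: "cinner (x + y) z = cinner x z + cinner y z"
    and cinner_scaleC_left: "cinner (a *\<^sub>C x) y = a * cinner x y"
    and cinner_self: "cinner x x = complex_of_real ((norm x)\<^sup>2)"

class complex_hilbert_space = complex_inner + complete_space

instantiation complex :: complex_hilbert_space
begin

definition scaleC_complex :: "complex \<Rightarrow> complex \<Rightarrow> complex"
  where "scaleC_complex a x = a * x"

definition cinner_complex :: "complex \<Rightarrow> complex \<Rightarrow> complex"
  where "cinner_complex x y = x * cnj y"

instance
proof
  fix x :: complex
  show "cinner x x = complex_of_real ((norm x)\<^sup>2)"
    by (simp add: cinner_complex_def complex_norm_square del: of_real_power)
qed (simp_all add: scaleC_complex_def cinner_complex_def algebra_simps scaleR_conv_of_real)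

end

definition bounded_clinear ::
    "('a::complex_inner \<Rightarrow> 'b::complex_inner) \<Rightarrow> bool"
  where "bounded_clinear f \<longleftrightarrow> bounded_linear f \<and> (\<forall>a x. f (a *\<^sub>C x) = a *\<^sub>C f x)"

definition inverse_operators ::
    "('a::complex_inner \<Rightarrow> 'a) \<Rightarrow> ('a \<Rightarrow> 'a) \<Rightarrow> bool"
  where "inverse_operators A B \<longleftrightarrow>
    bounded_clinear A \<and> bounded_clinear B \<and> B \<circ> A = id \<and> A \<circ> B = id"

definition spectrum :: "('a::complex_inner \<Rightarrow> 'a) \<Rightarrow> complex set"
  where "spectrum T = {z. \<not> (\<exists>R. inverse_operators (\<lambda>x. z *\<^sub>C x - T x) R)}"

text \<open>Only meaningful for \<open>z\<close> outside the spectrum.\<close>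

definition resolvent :: "('a::complex_inner \<Rightarrow> 'a) \<Rightarrow> complex \<Rightarrow> 'a \<Rightarrow> 'a"
  where "resolvent T z = inv (\<lambda>x. z *\<^sub>C x - T x)"

definition Kreiss_condition :: "('a::complex_inner \<Rightarrow> 'a) \<Rightarrow> bool"
  where "Kreiss_condition T \<longleftrightarrow> (\<exists>C. \<forall>z. 1 < cmod z \<longrightarrow>
    z \<notin> spectrum T \<and> onorm (resolvent T z) \<le> C / (cmod z - 1))"

definition similar_to_contraction :: "('a::complex_inner \<Rightarrow> 'a) \<Rightarrow> bool"
  where "similar_to_contraction T \<longleftrightarrow>
    (\<exists>S S'. inverse_operators S S' \<and> onorm (S \<circ> T \<circ> S') \<le> 1)"

text \<open>
  The integrand in the last condition is nonnegative and continuous off \<open>\<theta> = 0\<close>, so its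
  integrability says exactly that its integral is finite.  Its value at the null set
  \<open>\<theta> = 0\<close>, where it is infinite on paper and \<open>1 / 0 = 0\<close> here, is irrelevant.
\<close>

definition v_type_curve :: "real \<Rightarrow> real \<Rightarrow> (real \<Rightarrow> complex) \<Rightarrow> bool"
  where "v_type_curve \<delta>m \<delta>p \<gamma> \<longleftrightarrow>
    \<delta>m \<in> {0<..<pi} \<and> \<delta>p \<in> {0<..<pi} \<and>
    (\<exists>r. continuous_on {-\<delta>m..\<delta>p} r \<and>
      (\<forall>\<theta>\<in>{-\<delta>m..\<delta>p}. 1 \<le> r \<theta> \<and> \<gamma> \<theta> = complex_of_real (r \<theta>) * cis (- \<theta>)) \<and>
      strict_mono_on {0..\<delta>p} r \<and> strict_antimono_on {-\<delta>m..0} r \<and>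
      r 0 = 1 \<and> r (-\<delta>m) = r \<delta>p \<and> 1 < r \<delta>p \<and>
      set_integrable lborel {-\<delta>m..\<delta>p} (\<lambda>\<theta>. 1 / (r \<theta> - 1)))"

definition v_type_set :: "real \<Rightarrow> real \<Rightarrow> (real \<Rightarrow> complex) \<Rightarrow> complex set"
  where "v_type_set \<delta>m \<delta>p \<gamma> =
    {complex_of_real \<rho> * cis (- \<theta>) | \<rho> \<theta>.
      \<theta> \<in> {-\<delta>m..\<delta>p} \<and> cmod (\<gamma> \<theta>) \<le> \<rho> \<and> \<rho> \<le> cmod (\<gamma> \<delta>p)}"

end

theory Submission
  imports Defs "HOL-Complex_Analysis.Complex_Analysis"
begin

text \<open>
  For a contraction the Poisson kernel \<open>P(\<theta>) = 2 Re (1 - e\<^sup>i\<^sup>\<theta> T)\<^sup>-\<^sup>1 - 1\<close> is a positive operator.  Here it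
  is shown to satisfy \<open>P(\<theta>) \<ge> - w(\<theta>)\<close> with an integrable scalar weight \<open>w \<ge> 0\<close>, uniformly when
  \<open>T\<close> is replaced by \<open>s T\<close> with \<open>s\<close> close to \<open>1\<close>; such a one-sided bound already
  forces similarity to a contraction.

  \<^bold>\<open>From the bound to a new norm.\<close>  For an \<open>H\<close>-valued polynomial \<open>p = \<Sum> z\<^sup>k x\<^sub>k\<close> the mean of
  \<open>\<langle>P p, p\<rangle>\<close> over the circle is the Toeplitz form
  \<open>B(p) = \<Sum>k. \<parallel>x\<^sub>k\<parallel>\<^sup>2 + 2 \<Sum>j<k. Re \<langle>T\<^sup>k\<^sup>-\<^sup>j x\<^sub>k, x\<^sub>j\<rangle>\<close>.  With \<open>W(p)\<close> the mean of
  \<open>w \<parallel>p\<parallel>\<^sup>2\<close>, the bound says \<open>B + W \<ge> 0\<close>.  Testing it on \<open>p - y\<close> with a constant \<open>y\<close> shows that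
  \<open>q = B + 2 W\<close> dominates a multiple of \<open>\<parallel>p(T)\<parallel>\<^sup>2\<close>, where \<open>p(T) = \<Sum> T\<^sup>k x\<^sub>k\<close>.  Therefore
  \<open>N(x) = inf {q(p) | p(T) = x}\<close> is the square of an equivalent Hilbertian norm, and since
  \<open>q(z p) = q(p)\<close> while \<open>(z p)(T) = T p(T)\<close>, \<open>T\<close> is a contraction for it.  This is the lemma
  \<open>similar_to_contraction_if_toeplitz_form_bounded_below\<close>; it replaces a unitary dilation by an
  explicit quotient norm.

  \<^bold>\<open>From a new norm to a similarity.\<close>  The lemma \<open>similar_to_contraction_if_hilbertian_norm\<close>
  represents \<open>N\<close> by a positive operator, through the theorems of Jordan and von Neumann and of Riesz,
  and takes the square root of that operator as \<open>S\<close>.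

  \<^bold>\<open>The bound.\<close>  Let \<open>\<rho> = 1 / s > 1\<close>, \<open>\<omega> = e\<^sup>-\<^sup>i\<^sup>\<theta>\<close> and \<open>x = (\<rho> \<omega> - T) y\<close>.  If \<open>\<rho>' > \<rho>\<close> and
  \<open>\<rho>' \<omega>\<close> lies in the set determined by \<open>\<gamma>\<close>, the resolvent estimate bounds the norm of
  \<open>(\<rho>' \<omega> - T) y = (\<rho>' - \<rho>) \<omega> y + x\<close> from below, and expanding the square gives a lower bound for
  \<open>Re \<langle>\<omega> y, x\<rangle>\<close>.  If \<open>\<rho>\<close> is small compared with \<open>r(\<theta>)\<close>, one takes \<open>\<rho>' = r(\<theta>)\<close>; the loss is
  \<open>O(1 / (r - 1))\<close> plus a term containing \<open>\<epsilon>(r - 1) \<parallel>y\<parallel>\<^sup>2\<close>, and by the Kreiss condition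
  \<open>\<parallel>y\<parallel>\<close> is at most a multiple of \<open>\<parallel>(\<omega> - T)\<^sup>-\<^sup>1\<parallel> \<parallel>x\<parallel>\<close>.  Otherwise one takes
  \<open>\<rho>' - 1 = 2 (\<rho> - 1)\<close>: the factor \<open>2\<close> absorbs \<open>1 + \<epsilon>\<close>, and the loss \<open>1 / (\<rho> - 1)\<close> is again
  \<open>O(1 / (r - 1))\<close>.  Both losses are integrable by hypothesis, and off the curve's angles the
  resolvent is bounded on the unit circle by compactness.
\<close>

section \<open>Complex inner product spaces\<close>

instance complex_hilbert_space \<subseteq> banach ..

lemma cinner_scaleC_right: "cinner x (a *\<^sub>C y) = cnj a * cinner x y"
  for x y :: "'a::complex_inner"
  by (metis cinner_commute cinner_scaleC_left complex_cnj_mult)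

lemma cinner_add_right: "cinner x (y + z) = cinner x y + cinner x z"
  for x y z :: "'a::complex_inner"
  by (metis cinner_commute cinner_add_left complex_cnj_add)

lemma norm_scaleC: "norm (a *\<^sub>C x) = cmod a * norm x"
  for x :: "'a::complex_inner"
proof -
  have "complex_of_real ((norm (a *\<^sub>C x))\<^sup>2) = a * cnj a * cinner x x"
    using cinner_self[of "a *\<^sub>C x"]
    by (simp only: cinner_scaleC_left cinner_scaleC_right mult_ac)
  also have "\<dots> = complex_of_real ((cmod a * norm x)\<^sup>2)"
    by (simp only: cinner_self complex_norm_square[symmetric] of_real_mult[symmetric] power_mult_distrib)
  finally have "(norm (a *\<^sub>C x))\<^sup>2 = (cmod a * norm x)\<^sup>2" by (simp only: of_real_eq_iff)
  then show ?thesis by simp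
qed

lemma scaleR_scaleC_commute: "a *\<^sub>C t *\<^sub>R x = t *\<^sub>R a *\<^sub>C x"
  for x :: "'a::complex_inner"
  by (simp only: scaleC_of_real[symmetric] scaleC_scaleC mult.commute)

text \<open>Most of the Hilbert space geometry below is that of the underlying real space; complex
  linearity is recovered at the end from commutation with \<open>\<i>\<close>.\<close>

definition rinner :: "'a::complex_inner \<Rightarrow> 'a \<Rightarrow> real"
  where "rinner x y = Re (cinner x y)"

lemma scaleR_eq_scaleC: "t *\<^sub>R x = complex_of_real t *\<^sub>C x"
  for x :: "'a::complex_inner"
  by (simp add: scaleC_of_real)

lemma scaleC_one: "1 *\<^sub>C x = x" for x :: "'a::complex_inner"
  using scaleC_of_real[of 1 x] by simp

lemma cinner_scaleR_left: "cinner (t *\<^sub>R x) y = of_real t * cinner x y"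
  for x y :: "'a::complex_inner"
  by (simp add: scaleR_eq_scaleC cinner_scaleC_left)

lemma cinner_scaleR_right: "cinner x (t *\<^sub>R y) = of_real t * cinner x y"
  for x y :: "'a::complex_inner"
  by (simp add: scaleR_eq_scaleC cinner_scaleC_right)

lemma rinner_commute: "rinner x y = rinner y x"
  unfolding rinner_def by (subst cinner_commute) simp

lemma rinner_add_left: "rinner (x + y) z = rinner x z + rinner y z"
  by (simp add: rinner_def cinner_add_left)

lemma rinner_add_right: "rinner x (y + z) = rinner x y + rinner x z"
  by (simp add: rinner_def cinner_add_right)

lemma rinner_scaleR_left: "rinner (t *\<^sub>R x) z = t * rinner x z"
  by (simp add: rinner_def cinner_scaleR_left)

lemma rinner_scaleR_right: "rinner x (t *\<^sub>R z) = t * rinner x z"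
  by (simp add: rinner_def cinner_scaleR_right)

lemma rinner_minus_left: "rinner (- x) z = - rinner x z"
  using rinner_scaleR_left[of "-1" x z] by simp

lemma rinner_minus_right: "rinner x (- z) = - rinner x z"
  using rinner_scaleR_right[of x "-1" z] by simp

lemma rinner_diff_left: "rinner (x - y) z = rinner x z - rinner y z"
  using rinner_add_left[of x "-y" z] by (simp add: rinner_minus_left)

lemma rinner_diff_right: "rinner x (y - z) = rinner x y - rinner x z"
  using rinner_add_right[of x y "-z"] by (simp add: rinner_minus_right)

lemma rinner_self: "rinner x x = (norm x)\<^sup>2"
  by (simp add: rinner_def cinner_self del: of_real_power)

lemmas rinner_simps = rinner_add_left rinner_add_right rinner_diff_left rinner_diff_right
  rinner_minus_left rinner_minus_right rinner_scaleR_left rinner_scaleR_right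

lemma norm_add_sq: "(norm (x + y))\<^sup>2 = (norm x)\<^sup>2 + 2 * rinner x y + (norm y)\<^sup>2"
  for x y :: "'a::complex_inner"
  by (simp add: rinner_self[symmetric] rinner_simps rinner_commute)

lemma norm_diff_sq: "(norm (x - y))\<^sup>2 = (norm x)\<^sup>2 - 2 * rinner x y + (norm y)\<^sup>2"
  for x y :: "'a::complex_inner"
  by (simp add: rinner_self[symmetric] rinner_simps rinner_commute)

lemma parallelogram_norm:
  "(norm (x + y))\<^sup>2 + (norm (x - y))\<^sup>2 = 2 * (norm x)\<^sup>2 + 2 * (norm y)\<^sup>2"
  for x y :: "'a::complex_inner"
  by (simp add: norm_add_sq norm_diff_sq)

lemma rinner_scaleC_both: "rinner (a *\<^sub>C x) (a *\<^sub>C y) = (cmod a)\<^sup>2 * rinner x y"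
proof -
  have "cinner (a *\<^sub>C x) (a *\<^sub>C y) = complex_of_real ((cmod a)\<^sup>2) * cinner x y"
    by (simp only: cinner_scaleC_left cinner_scaleC_right complex_norm_square mult.assoc
        mult.left_commute)
  then show ?thesis by (simp add: rinner_def del: of_real_power)
qed

lemma rinner_le_norm: "rinner x y \<le> norm x * norm y"
proof -
  have "(norm (norm y *\<^sub>R x - norm x *\<^sub>R y))\<^sup>2
      = 2 * ((norm x * norm y) * (norm x * norm y - rinner x y))"
    by (subst norm_diff_sq) (simp add: rinner_simps power2_eq_square algebra_simps)
  then have *: "0 \<le> (norm x * norm y) * (norm x * norm y - rinner x y)"
    using zero_le_power2[of "norm (norm y *\<^sub>R x - norm x *\<^sub>R y)"] by linarith
  show ?thesis
  proof (cases "x = 0 \<or> y = 0")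
    case True
    then show ?thesis using rinner_scaleR_left[of 0 x y] rinner_scaleR_right[of x 0 y] by auto
  next
    case False
    then have "0 < norm x * norm y" by simp
    with * show ?thesis by (simp add: zero_le_mult_iff)
  qed
qed

lemma abs_rinner_le_norm: "\<bar>rinner x y\<bar> \<le> norm x * norm y"
  using rinner_le_norm[of x y] rinner_le_norm[of "-x" y] by (simp add: rinner_minus_left)

lemma Im_cinner: "Im (cinner x y) = rinner (- \<i> *\<^sub>C x) y"
  by (simp add: rinner_def cinner_scaleC_left)

lemma bounded_bilinear_rinner: "bounded_bilinear rinner"
  by (rule bounded_bilinear.intro)
     (auto simp: rinner_simps intro!: exI[of _ 1] abs_rinner_le_norm)

lemma bounded_bilinear_scaleC: "bounded_bilinear (scaleC :: complex \<Rightarrow> 'a \<Rightarrow> 'a::complex_inner)"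
proof (rule bounded_bilinear.intro)
  show "\<exists>K. \<forall>a (b :: 'a). norm (a *\<^sub>C b) \<le> norm a * norm b * K"
    by (rule exI[of _ 1]) (simp add: norm_scaleC)
  show "(r *\<^sub>R a) *\<^sub>C b = r *\<^sub>R a *\<^sub>C b" for r a and b :: 'a
    by (simp only: scaleC_of_real[symmetric, of r b] scaleC_of_real[symmetric, of r "a *\<^sub>C b"]
        scaleC_scaleC scaleR_conv_of_real)
  show "a *\<^sub>C r *\<^sub>R b = r *\<^sub>R a *\<^sub>C b" for r a and b :: 'a
    by (rule scaleR_scaleC_commute)
qed (simp_all add: scaleC_add_left scaleC_add_right)

lemma bounded_bilinear_cinner: "bounded_bilinear (cinner :: 'a::complex_inner \<Rightarrow> 'a \<Rightarrow> complex)"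
proof (rule bounded_bilinear.intro)
  show "\<exists>K. \<forall>(a::'a) b. norm (cinner a b) \<le> norm a * norm b * K"
  proof (intro exI allI)
    fix a b :: 'a
    have "cmod (cinner a b) \<le> \<bar>Re (cinner a b)\<bar> + \<bar>Im (cinner a b)\<bar>" by (rule cmod_le)
    also have "\<dots> \<le> norm a * norm b + norm a * norm b"
      using abs_rinner_le_norm[of a b] abs_rinner_le_norm[of "-\<i> *\<^sub>C a" b]
      by (intro add_mono) (auto simp: Im_cinner norm_scaleC, simp add: rinner_def)
    finally show "norm (cinner a b) \<le> norm a * norm b * 2" by simp
  qed
qed (auto simp: cinner_add_left cinner_add_right cinner_scaleR_left cinner_scaleR_right scaleR_conv_of_real)

lemmas scaleC_diff_right = bounded_bilinear.diff_right[OF bounded_bilinear_scaleC]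
lemmas scaleC_diff_left = bounded_bilinear.diff_left[OF bounded_bilinear_scaleC]
lemmas scaleC_zero_left = bounded_bilinear.zero_left[OF bounded_bilinear_scaleC]
lemmas scaleC_zero_right = bounded_bilinear.zero_right[OF bounded_bilinear_scaleC]
lemmas cinner_zero_left = bounded_bilinear.zero_left[OF bounded_bilinear_cinner]
lemmas cinner_zero_right = bounded_bilinear.zero_right[OF bounded_bilinear_cinner]

lemma linear_commute_i_imp_scaleC:
  fixes f :: "'a::complex_inner \<Rightarrow> 'b::complex_inner"
  assumes "linear f" and "\<And>x. f (\<i> *\<^sub>C x) = \<i> *\<^sub>C f x"
  shows "f (a *\<^sub>C x) = a *\<^sub>C f x"
proof -
  have split: "a *\<^sub>C y = Re a *\<^sub>R y + Im a *\<^sub>R (\<i> *\<^sub>C y)" for y :: "'c::complex_inner"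
    by (subst complex_eq) (simp add: scaleC_add_left scaleR_eq_scaleC scaleC_scaleC mult.commute)
  show ?thesis
    using assms by (subst (1 2) split) (simp add: linear_add linear_scale)
qed

section \<open>From an equivalent Hilbertian norm to a similarity\<close>

text \<open>The function is periodic, hence bounded everywhere, whereas \<open>g (n t) = n g t\<close> grows with
  \<open>n\<close> unless \<open>g t = 0\<close>.  It supplies the real homogeneity in the theorem of Jordan and von Neumann.\<close>

lemma additive_bounded_vanishes:
  fixes g :: "real \<Rightarrow> real"
  assumes add: "\<And>s t. g (s + t) = g s + g t" and one: "g 1 = 0"
    and bdd: "\<And>t. 0 \<le> t \<Longrightarrow> t \<le> 1 \<Longrightarrow> \<bar>g t\<bar> \<le> K"
  shows "g t = 0"
proof -
  have g0: "g 0 = 0" using add[of 0 0] by simp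
  have mult: "g (real n * s) = real n * g s" for n s
    by (induction n) (auto simp: g0 algebra_simps add)
  have neg: "g (- s) = - g s" for s using add[of s "-s"] g0 by simp
  have int: "g (of_int k) = 0" for k :: int
  proof (cases "0 \<le> k")
    case True
    then show ?thesis using mult[of "nat k" 1] one by simp
  next
    case False
    then show ?thesis using mult[of "nat (-k)" 1] one neg[of "of_int (-k)"] by simp
  qed
  have bound: "\<bar>g s\<bar> \<le> K" for s
  proof -
    have "g s = g (of_int \<lfloor>s\<rfloor>) + g (frac s)"
      unfolding add[symmetric] by (simp add: frac_def)
    then show ?thesis using int bdd[of "frac s"] by (simp add: frac_lt_1 less_imp_le)
  qed
  show ?thesis
  proof (rule ccontr)
    assume "g t \<noteq> 0"
    then obtain n :: nat where "K < real n * \<bar>g t\<bar>" using ex_less_of_nat_mult[of "\<bar>g t\<bar>" K] by auto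
    then show False using bound[of "real n * t"] by (simp add: mult abs_mult)
  qed
qed

text \<open>Additivity of the polarisation \<open>F\<close> comes from the parallelogram law at \<open>(x + z, y)\<close> and
  \<open>(x - z, y)\<close>.  Homogeneity follows as \<open>F (t x) y - t F x y\<close> is additive and locally
  bounded in \<open>t\<close>.\<close>

lemma jordan_von_neumann:
  fixes Q :: "'a::complex_inner \<Rightarrow> real"
  assumes par: "\<And>x y. Q (x + y) + Q (x - y) = 2 * Q x + 2 * Q y"
    and nonneg: "\<And>x. 0 \<le> Q x" and le: "\<And>x. Q x \<le> a * (norm x)\<^sup>2"
    and F_def: "\<And>x y. F x y = (Q (x + y) - Q (x - y)) / 4"
  shows "F x x = Q x" and "F x y = F y x" and "linear (\<lambda>x. F x y)"
    and "\<bar>F x y\<bar> \<le> a * norm x * norm y"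
proof -
  have Q0: "Q 0 = 0" using par[of 0 0] by simp
  have Qm: "Q (- x) = Q x" for x using par[of 0 x] Q0 by simp
  have Q2: "Q (x + x) = 4 * Q x" for x using par[of x x] Q0 by simp
  show "F x x = Q x" by (simp add: F_def Q2 Q0)
  have sym: "F x y = F y x" for x y
    using Qm[of "x - y"] by (simp add: F_def add.commute)
  then show "F x y = F y x" .
  have F0: "F 0 z = 0" for z by (simp add: F_def Qm)
  have mid: "F (x + y) z + F (x - y) z = 2 * F x z" for x y z
  proof -
    have "x + z + y = x + y + z" "x + z - y = x - y + z" "x - z + y = x + y - z"
      "x - z - y = x - y - z" by simp_all
    then show ?thesis using par[of "x + z" y] par[of "x - z" y] unfolding F_def by (simp add: field_simps)
  qed
  have dbl: "F (x + x) z = 2 * F x z" for x z using mid[of x x z] F0 by simp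
  have add: "F (x + y) z = F x z + F y z" for x y z
  proof -
    define u v where "u = (1/2) *\<^sub>R (x + y)" and "v = (1/2) *\<^sub>R (x - y)"
    have "u + v = x" "u - v = y" "u + u = x + y"
      by (auto simp: u_def v_def algebra_simps simp flip: scaleR_add_left)
    then show ?thesis using mid[of u v z] dbl[of u z] by simp
  qed
  have minus: "F (- x) z = - F x z" for x z using add[of x "-x" z] F0 by simp
  have a0: "0 \<le> a" if "x \<noteq> 0" for x :: 'a
    using order_trans[OF nonneg le, of x] that by (simp add: zero_le_mult_iff)
  have crude: "\<bar>F x z\<bar> \<le> a * (norm x + norm z)\<^sup>2 / 4" for x z
  proof (cases "x = 0 \<and> z = 0")
    case True
    then show ?thesis by (simp add: F0)
  next
    case False
    then have a: "0 \<le> a" using a0 by auto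
    have "Q (x + z) \<le> a * (norm x + norm z)\<^sup>2"
      by (rule order_trans[OF le]) (simp add: a mult_left_mono norm_triangle_ineq power_mono)
    moreover have "Q (x - z) \<le> a * (norm x + norm z)\<^sup>2"
      by (rule order_trans[OF le]) (simp add: a mult_left_mono norm_triangle_ineq4 power_mono)
    ultimately show ?thesis using nonneg[of "x + z"] nonneg[of "x - z"] by (simp add: F_def)
  qed
  have scale: "F (t *\<^sub>R x) z = t * F x z" for t x z
  proof -
    have "F (t *\<^sub>R x) z - t * F x z = 0"
    proof (rule additive_bounded_vanishes[where g = "\<lambda>t. F (t *\<^sub>R x) z - t * F x z"
          and K = "a * (norm x + norm z)\<^sup>2 / 4 + \<bar>F x z\<bar>"])
      fix s t :: real
      show "F ((s + t) *\<^sub>R x) z - (s + t) * F x z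
          = (F (s *\<^sub>R x) z - s * F x z) + (F (t *\<^sub>R x) z - t * F x z)"
        by (simp add: scaleR_add_left add algebra_simps)
    next
      fix t :: real assume t: "0 \<le> t" "t \<le> 1"
      show "\<bar>F (t *\<^sub>R x) z - t * F x z\<bar> \<le> a * (norm x + norm z)\<^sup>2 / 4 + \<bar>F x z\<bar>"
      proof (cases "x = 0")
        case True
        then show ?thesis by (cases "z = 0") (use a0 t in \<open>auto simp: F0\<close>)
      next
        case False
        then have a: "0 \<le> a" using a0 by auto
        have "\<bar>F (t *\<^sub>R x) z\<bar> \<le> a * (norm (t *\<^sub>R x) + norm z)\<^sup>2 / 4" by (rule crude)
        also have "\<dots> \<le> a * (norm x + norm z)\<^sup>2 / 4"
          using t a by (intro divide_right_mono mult_left_mono power_mono add_right_mono)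
            (auto intro: mult_left_le_one_le)
        finally have "\<bar>F (t *\<^sub>R x) z\<bar> \<le> a * (norm x + norm z)\<^sup>2 / 4" .
        moreover have "\<bar>t * F x z\<bar> \<le> \<bar>F x z\<bar>"
          using t by (simp add: abs_mult mult_left_le_one_le)
        ultimately show ?thesis by linarith
      qed
    qed simp
    then show ?thesis by simp
  qed
  show "linear (\<lambda>x. F x y)" by (rule linearI) (auto simp: add scale)
  show "\<bar>F x y\<bar> \<le> a * norm x * norm y"
  proof (cases "x = 0 \<or> y = 0")
    case True
    then show ?thesis using F0 sym[of x y] by auto
  next
    case False
    define u v where "u = (1 / norm x) *\<^sub>R x" and "v = (1 / norm y) *\<^sub>R y"
    have "x = norm x *\<^sub>R u" "y = norm y *\<^sub>R v" "norm u = 1" "norm v = 1"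
      using False by (auto simp: u_def v_def)
    then have "F x y = norm x * norm y * F u v" and "\<bar>F u v\<bar> \<le> a"
      using scale sym crude[of u v] by (metis mult.assoc, simp)
    then show ?thesis
      by (simp add: abs_mult) (metis mult.assoc mult.commute mult_left_mono norm_ge_zero)
  qed
qed

text \<open>The representing vector minimises \<open>\<parallel>y\<parallel>\<^sup>2 / 2 - f y\<close>; the parallelogram law makes
  every minimising sequence Cauchy.\<close>

lemma riesz_representation:
  fixes f :: "'a::complex_hilbert_space \<Rightarrow> real"
  assumes lin: "linear f" and bdd: "\<And>x. \<bar>f x\<bar> \<le> K * norm x"
  shows "\<exists>g. \<forall>y. f y = rinner y g"
proof -
  define J where "J y = (norm y)\<^sup>2 / 2 - f y" for y
  have below: "- K\<^sup>2 / 2 \<le> J y" for y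
  proof -
    have "0 \<le> (norm y - K)\<^sup>2" by simp
    then show ?thesis using bdd[of y] unfolding J_def by (simp add: power2_diff abs_le_iff algebra_simps)
  qed
  define d where "d = Inf (range J)"
  have bb: "bdd_below (range J)" using below by (auto intro: bdd_belowI[of _ "- K\<^sup>2 / 2"])
  have dJ: "d \<le> J y" for y unfolding d_def by (rule cInf_lower[OF _ bb]) simp
  have "\<exists>y. J y < d + 1 / real (Suc n)" for n
  proof -
    have "Inf (range J) < d + 1 / real (Suc n)" by (simp add: d_def)
    then show ?thesis using cInf_lessD[of "range J" "d + 1 / real (Suc n)"] by auto
  qed
  then obtain y where y: "\<And>n. J (y n) < d + 1 / real (Suc n)" by metis
  have mid: "(norm (u - v))\<^sup>2 = 4 * (J u + J v - 2 * J ((1/2) *\<^sub>R (u + v)))" for u v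
  proof -
    have "J ((1/2) *\<^sub>R (u + v)) = (norm (u + v))\<^sup>2 / 8 - (f u + f v) / 2"
      unfolding J_def by (simp only: linear_add[OF lin] linear_scale[OF lin] norm_scaleR power_mult_distrib)
        (simp add: power2_eq_square)
    then show ?thesis using parallelogram_norm[of u v] by (simp add: J_def field_simps)
  qed
  have "Cauchy y"
  proof (rule metric_CauchyI)
    fix e :: real assume e: "0 < e"
    obtain M :: nat where M: "8 / e\<^sup>2 < real (Suc M)"
      using reals_Archimedean2 less_trans of_nat_less_iff by (metis lessI)
    have "dist (y m) (y n) < e" if mn: "m \<ge> M" "n \<ge> M" for m n
    proof -
      have small: "1 / real (Suc k) \<le> 1 / real (Suc M)" if "k \<ge> M" for k
        using that by (simp add: frac_le)
      have "(norm (y m - y n))\<^sup>2 \<le> 4 * (2 * (1 / real (Suc M)))"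
        unfolding mid using y[of m] y[of n] dJ[of "(1/2) *\<^sub>R (y m + y n)"] small[OF mn(1)] small[OF mn(2)]
        by (smt (verit))
      also have "\<dots> < e\<^sup>2" using M e by (simp add: field_simps)
      finally show ?thesis using e by (simp add: dist_norm power2_less_imp_less)
    qed
    then show "\<exists>M. \<forall>m\<ge>M. \<forall>n\<ge>M. dist (y m) (y n) < e" by blast
  qed
  then obtain g where g: "y \<longlonglongrightarrow> g" using Cauchy_convergent convergent_def by blast
  have bl: "bounded_linear f"
    by (intro bounded_linear_intro[where K = K])
       (use bdd in \<open>auto simp: linear_add[OF lin] linear_scale[OF lin] mult.commute\<close>)
  have "(\<lambda>n. J (y n)) \<longlonglongrightarrow> J g"
    unfolding J_def by (intro tendsto_intros g bounded_linear.tendsto[OF bl])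
       (auto intro: tendsto_intros g)
  moreover have "(\<lambda>n. d + 1 / real (Suc n)) \<longlonglongrightarrow> d + 0"
    by (intro tendsto_add tendsto_const LIMSEQ_Suc lim_1_over_n)
  ultimately have Jg: "J g \<le> d"
    using LIMSEQ_le[of "\<lambda>n. J (y n)" "J g" "\<lambda>n. d + 1 / real (Suc n)" "d + 0"] y
    by (auto intro: less_imp_le)
  have "f z = rinner z g" for z
  proof -
    define b where "b = rinner z g - f z"
    have ineq: "0 \<le> t * b + t\<^sup>2 * (norm z)\<^sup>2 / 2" for t
    proof -
      have "J (g + t *\<^sub>R z) - J g = t * b + t\<^sup>2 * (norm z)\<^sup>2 / 2"
        by (simp add: J_def b_def norm_add_sq rinner_simps rinner_commute[of g] linear_add[OF lin]
            linear_scale[OF lin] power_mult_distrib field_simps)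
      then show ?thesis using Jg dJ[of "g + t *\<^sub>R z"] by linarith
    qed
    \<comment> \<open>evaluate at a step so short that the linear term dominates\<close>
    have "b = 0"
    proof (rule ccontr)
      assume b: "b \<noteq> 0"
      define c where "c = (norm z)\<^sup>2 + 1"
      have c: "0 < c" by (simp add: c_def add_nonneg_pos)
      have "0 \<le> (- b / c) * b + (- b / c)\<^sup>2 * (norm z)\<^sup>2 / 2" by (rule ineq)
      also have "\<dots> \<le> (- b / c) * b + (- b / c)\<^sup>2 * c / 2"
        by (intro add_left_mono divide_right_mono mult_left_mono) (auto simp: c_def)
      also have "\<dots> = - (b\<^sup>2 / (2 * c))" using c by (simp add: power2_eq_square field_simps)
      also have "\<dots> < 0" using b c by simp
      finally show False by simp
    qed
    then show ?thesis by (simp add: b_def)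
  qed
  then show ?thesis by blast
qed

lemma eq_of_rinner_eq:
  assumes "\<And>y. rinner y u = rinner y v" shows "u = v"
proof -
  have "rinner (u - v) (u - v) = 0" using assms by (simp add: rinner_diff_right)
  then show ?thesis by (simp add: rinner_self)
qed

text \<open>The operator represents the polarisation of \<open>Q\<close>.  Invariance of \<open>Q\<close> under \<open>\<i>\<close>
  makes it complex linear, by uniqueness of the representing vector.\<close>

lemma operator_of_quadratic_form:
  fixes Q :: "'a::complex_hilbert_space \<Rightarrow> real"
  assumes par: "\<And>x y. Q (x + y) + Q (x - y) = 2 * Q x + 2 * Q y"
    and nonneg: "\<And>x. 0 \<le> Q x" and le: "\<And>x. Q x \<le> a * (norm x)\<^sup>2"
    and rot: "\<And>x. Q (\<i> *\<^sub>C x) = Q x" and "0 \<le> a"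
  shows "\<exists>A. linear A \<and> (\<forall>x. A (\<i> *\<^sub>C x) = \<i> *\<^sub>C A x) \<and> (\<forall>x. norm (A x) \<le> a * norm x) \<and>
    (\<forall>x y. rinner (A x) y = rinner x (A y)) \<and> (\<forall>x. rinner x (A x) = Q x)"
proof -
  define F where "F x y = (Q (x + y) - Q (x - y)) / 4" for x y
  note jvn = jordan_von_neumann[OF par nonneg le F_def]
  have "\<exists>g. \<forall>y. F y x = rinner y g" for x
    by (rule riesz_representation[where K = "a * norm x"])
       (use jvn(3,4) in \<open>auto simp: mult_ac\<close>)
  then obtain A where A: "\<And>x y. F y x = rinner y (A x)" by metis
  have Fi: "F (\<i> *\<^sub>C x) (\<i> *\<^sub>C y) = F x y" for x y
    by (simp add: F_def scaleC_add_right[symmetric] scaleC_diff_right[symmetric] rot)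
  have lin2: "linear (F y)" for y
  proof -
    have "F y = (\<lambda>x. F x y)" using jvn(2) by auto
    then show ?thesis using jvn(3)[of y] by simp
  qed
  have "linear A"
  proof (rule linearI)
    show "A (x + y) = A x + A y" for x y
      by (rule eq_of_rinner_eq) (simp add: A[symmetric] rinner_add_right linear_add[OF lin2])
    show "A (t *\<^sub>R x) = t *\<^sub>R A x" for t x
      by (rule eq_of_rinner_eq) (simp add: A[symmetric] rinner_scaleR_right linear_scale[OF lin2])
  qed
  moreover have "A (\<i> *\<^sub>C x) = \<i> *\<^sub>C A x" for x
  proof (rule eq_of_rinner_eq)
    fix y :: 'a
    have y: "y = \<i> *\<^sub>C (- \<i> *\<^sub>C y)" by (simp add: scaleC_scaleC scaleC_one)
    have "rinner y (A (\<i> *\<^sub>C x)) = F (\<i> *\<^sub>C (- \<i> *\<^sub>C y)) (\<i> *\<^sub>C x)" using A y by simp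
    also have "\<dots> = rinner (- \<i> *\<^sub>C y) (A x)" by (subst Fi) (rule A)
    also have "\<dots> = rinner (\<i> *\<^sub>C (- \<i> *\<^sub>C y)) (\<i> *\<^sub>C A x)" by (simp only: rinner_scaleC_both) simp
    finally show "rinner y (A (\<i> *\<^sub>C x)) = rinner y (\<i> *\<^sub>C A x)" using y by simp
  qed
  moreover have "norm (A x) \<le> a * norm x" for x
  proof (cases "A x = 0")
    case False
    have "norm (A x) * norm (A x) = F (A x) x" by (simp add: A rinner_self power2_eq_square)
    also have "\<dots> \<le> (a * norm x) * norm (A x)"
      using jvn(4)[of "A x" x] by (simp add: mult_ac abs_le_iff)
    finally show ?thesis using False by simp
  qed (use \<open>0 \<le> a\<close> in simp)
  moreover have "rinner (A x) y = rinner x (A y)" for x y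
    using A[of y x] A[of x y] jvn(2)[of x y] by (simp add: rinner_commute)
  moreover have "rinner x (A x) = Q x" for x using A[of x x] jvn(1) by simp
  ultimately show ?thesis by blast
qed

text \<open>With \<open>Y = 1 - S\<close> the equation \<open>S\<^sup>2 = 1 - A\<close> becomes the fixed point equation
  \<open>Y = (A + Y\<^sup>2) / 2\<close>, whose right-hand side contracts the ball of radius \<open>\<surd>\<parallel>A\<parallel>\<close>.  The
  iteration stays inside the closed set of self-adjoint complex linear operators.\<close>

lemma exists_square_root_perturbation:
  fixes A :: "'a::complex_hilbert_space \<Rightarrow> 'a"
  assumes "linear A" and Ai: "\<And>x. A (\<i> *\<^sub>C x) = \<i> *\<^sub>C A x"
    and An: "\<And>x. norm (A x) \<le> a * norm x" and a: "0 \<le> a" "a < 1"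
    and As: "\<And>x y. rinner (A x) y = rinner x (A y)"
  shows "\<exists>Y. linear Y \<and> (\<forall>x. Y (\<i> *\<^sub>C x) = \<i> *\<^sub>C Y x) \<and> (\<forall>x. norm (Y x) \<le> sqrt a * norm x) \<and>
    (\<forall>x y. rinner (Y x) y = rinner x (Y y)) \<and> (\<forall>x. 2 *\<^sub>R Y x = A x + Y (Y x))"
proof -
  have blA: "bounded_linear A"
    by (rule bounded_linear_intro[where K = a])
       (use assms in \<open>auto simp: linear_add linear_scale mult.commute\<close>)
  define L where "L = Blinfun A"
  have L: "blinfun_apply L = A" unfolding L_def by (rule bounded_linear_Blinfun_apply[OF blA])
  have nL: "norm L \<le> a" using An a by (intro norm_blinfun_bound) (auto simp: L)
  define t where "t = sqrt a"
  have t: "0 \<le> t" "t < 1" "t * t = a" using a by (auto simp: t_def)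
  define X where "X = {Y :: 'a \<Rightarrow>\<^sub>L 'a. norm Y \<le> t \<and>
    (\<forall>x. blinfun_apply Y (\<i> *\<^sub>C x) = \<i> *\<^sub>C blinfun_apply Y x) \<and>
    (\<forall>x y. rinner (blinfun_apply Y x) y = rinner x (blinfun_apply Y y))}"
  define f :: "('a \<Rightarrow>\<^sub>L 'a) \<Rightarrow> ('a \<Rightarrow>\<^sub>L 'a)" where "f Y = (1/2) *\<^sub>R (L + (Y o\<^sub>L Y))" for Y
  have fa: "blinfun_apply (f Y) x = (1/2) *\<^sub>R (A x + blinfun_apply Y (blinfun_apply Y x))" for Y x
    by (simp add: f_def blinfun.bilinear_simps L)
  have contX: "continuous_on UNIV (\<lambda>Y :: 'a \<Rightarrow>\<^sub>L 'a. blinfun_apply Y x)" for x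
    by (intro continuous_intros)
  have "X = cball 0 t \<inter> (\<Inter>x. {Y. blinfun_apply Y (\<i> *\<^sub>C x) = \<i> *\<^sub>C blinfun_apply Y x}) \<inter>
      (\<Inter>x. \<Inter>y. {Y. rinner (blinfun_apply Y x) y = rinner x (blinfun_apply Y y)})"
    by (auto simp: X_def)
  moreover have "closed \<dots>"
    by (intro closed_Int closed_cball closed_INT ballI closed_Collect_eq continuous_on_diff continuous_on_const
        contX bounded_bilinear.continuous_on[OF bounded_bilinear_rinner]
        bounded_bilinear.continuous_on[OF bounded_bilinear_scaleC])
  ultimately have "complete X" by (simp add: complete_eq_closed)
  moreover have "X \<noteq> {}"
  proof -
    have "0 \<in> X"
      using t by (auto simp: X_def scaleC_zero_right bounded_bilinear.zero_left[OF bounded_bilinear_rinner]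
          bounded_bilinear.zero_right[OF bounded_bilinear_rinner])
    then show ?thesis by blast
  qed
  moreover have "f ` X \<subseteq> X"
  proof clarify
    fix Y assume Y: "Y \<in> X"
    have YY: "norm (Y o\<^sub>L Y) \<le> t * t"
      by (rule order_trans[OF norm_blinfun_compose]) (use Y t in \<open>auto simp: X_def intro: mult_mono\<close>)
    have "norm (f Y) \<le> (a + t * t) / 2"
      unfolding f_def using norm_triangle_ineq[of L "Y o\<^sub>L Y"] nL YY by simp
    also have "\<dots> \<le> t" using t mult_left_le[of t t] by simp
    finally show "f Y \<in> X"
      using Y As by (auto simp: X_def fa Ai rinner_simps scaleC_add_right scaleR_scaleC_commute)
  qed
  moreover have "\<forall>Y\<in>X. \<forall>Z\<in>X. dist (f Y) (f Z) \<le> t * dist Y Z"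
  proof clarify
    fix Y Z assume Y: "Y \<in> X" and Z: "Z \<in> X"
    have "f Y - f Z = (1/2) *\<^sub>R (((Y - Z) o\<^sub>L Y) + (Z o\<^sub>L (Y - Z)))"
      by (rule blinfun_eqI) (simp add: fa blinfun.bilinear_simps algebra_simps)
    then have "norm (f Y - f Z) \<le> (norm ((Y - Z) o\<^sub>L Y) + norm (Z o\<^sub>L (Y - Z))) / 2"
      using norm_triangle_ineq[of "(Y - Z) o\<^sub>L Y" "Z o\<^sub>L (Y - Z)"] by simp
    also have "\<dots> \<le> (norm (Y - Z) * t + t * norm (Y - Z)) / 2"
      by (intro divide_right_mono add_mono order_trans[OF norm_blinfun_compose] mult_mono)
         (use Y Z t in \<open>auto simp: X_def\<close>)
    finally show "dist (f Y) (f Z) \<le> t * dist Y Z" by (simp add: dist_norm)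
  qed
  ultimately have "\<exists>!Y\<in>X. f Y = Y" using t Banach_fix[of X t f] by blast
  then obtain Y where Y: "Y \<in> X" "f Y = Y" by blast
  have "2 *\<^sub>R Y x = A x + Y (Y x)" for x
  proof -
    have "Y x = (1/2) *\<^sub>R (A x + Y (Y x))" using fa[of Y x] Y(2) by simp
    then have "2 *\<^sub>R Y x = 2 *\<^sub>R ((1/2) *\<^sub>R (A x + Y (Y x)))" by simp
    then show ?thesis by simp
  qed
  moreover have "norm (Y x) \<le> sqrt a * norm x" for x
    by (rule order_trans[OF norm_blinfun]) (use Y(1) in \<open>auto simp: X_def t_def mult_right_mono\<close>)
  moreover have "linear (blinfun_apply Y)" by (rule bounded_linear.linear[OF blinfun.bounded_linear_right])
  ultimately show ?thesis using Y(1) unfolding X_def by blast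
qed

text \<open>After rescaling, \<open>N = \<parallel>\<cdot>\<parallel>\<^sup>2 - Q\<close> where the form \<open>Q\<close> belongs to an operator \<open>A\<close> of norm
  less than \<open>1\<close>; the square root \<open>S\<close> of \<open>1 - A\<close> then satisfies \<open>\<parallel>S x\<parallel>\<^sup>2 = N x\<close>, and
  \<open>1 - S\<close> has norm less than \<open>1\<close>, so \<open>S\<close> is invertible.\<close>

theorem similar_to_contraction_if_hilbertian_norm:
  fixes T :: "'a::complex_hilbert_space \<Rightarrow> 'a" and N :: "'a \<Rightarrow> real"
  assumes par: "\<And>x y. N (x + y) + N (x - y) = 2 * N x + 2 * N y"
    and rot: "\<And>x. N (\<i> *\<^sub>C x) = N x"
    and lower: "\<And>x. m * (norm x)\<^sup>2 \<le> N x" and upper: "\<And>x. N x \<le> M * (norm x)\<^sup>2"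
    and m: "0 < m" and contr: "\<And>x. N (T x) \<le> N x"
  shows "similar_to_contraction T"
proof -
  define M' where "M' = max M m"
  have M': "0 < M'" "m \<le> M'" using m by (auto simp: M'_def)
  have upper': "N x \<le> M' * (norm x)\<^sup>2" for x
    by (rule order_trans[OF upper]) (simp add: M'_def mult_right_mono)
  define Q where "Q x = (norm x)\<^sup>2 - N x / M'" for x
  define a where "a = 1 - m / M'"
  have a: "0 \<le> a" "a < 1" using M' m by (auto simp: a_def)
  have Qpar: "Q (x + y) + Q (x - y) = 2 * Q x + 2 * Q y" for x y
    using parallelogram_norm[of x y] arg_cong[OF par[of x y], of "\<lambda>s. s / M'"]
    by (simp add: Q_def add_divide_distrib)
  have Q0: "0 \<le> Q x" for x using upper'[of x] M'(1) by (simp add: Q_def field_simps)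
  have Qle: "Q x \<le> a * (norm x)\<^sup>2" for x
    using lower[of x] M'(1) by (simp add: Q_def a_def field_simps)
  have Qrot: "Q (\<i> *\<^sub>C x) = Q x" for x by (simp add: Q_def rot norm_scaleC)
  obtain A where A: "linear A" "\<And>x. A (\<i> *\<^sub>C x) = \<i> *\<^sub>C A x" "\<And>x. norm (A x) \<le> a * norm x"
    "\<And>x y. rinner (A x) y = rinner x (A y)" "\<And>x. rinner x (A x) = Q x"
    using operator_of_quadratic_form[OF Qpar Q0 Qle Qrot a(1)] by blast
  obtain Y where Y: "linear Y" "\<And>x. Y (\<i> *\<^sub>C x) = \<i> *\<^sub>C Y x" "\<And>x. norm (Y x) \<le> sqrt a * norm x"
    "\<And>x y. rinner (Y x) y = rinner x (Y y)" "\<And>x. 2 *\<^sub>R Y x = A x + Y (Y x)"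
    using exists_square_root_perturbation[OF A(1-3) a A(4)] by blast
  define t where "t = sqrt a"
  have t: "0 \<le> t" "t < 1" using a by (auto simp: t_def)
  have Yt: "norm (Y x) \<le> t * norm x" for x using Y(3) by (simp add: t_def)
  define S where "S x = x - Y x" for x
  have linS: "linear S" unfolding S_def by (intro linear_compose_sub Y(1) linear_ident)
  have Si: "S (\<i> *\<^sub>C x) = \<i> *\<^sub>C S x" for x by (simp add: S_def Y(2) scaleC_diff_right)
  have normS: "(norm (S x))\<^sup>2 = N x / M'" for x
  proof -
    have "rinner x (2 *\<^sub>R Y x) = rinner x (A x) + rinner x (Y (Y x))"
      using Y(5)[of x] by (simp add: rinner_add_right)
    then have "2 * rinner x (Y x) - rinner (Y x) (Y x) = Q x"
      using Y(4)[of x "Y x"] A(5) by (simp add: rinner_scaleR_right)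
    then show ?thesis by (simp add: S_def norm_diff_sq Q_def rinner_self)
  qed
  have below: "(1 - t) * norm x \<le> norm (S x)" for x
    using norm_triangle_ineq2[of x "Y x"] Yt[of x] by (simp add: S_def algebra_simps)
  have above: "norm (S x) \<le> 2 * norm x" for x
    using norm_triangle_ineq4[of x "Y x"] Yt[of x] t mult_right_mono[of t 1 "norm x"] by (simp add: S_def)
  have injS: "inj S"
  proof (rule linear_injective_0[OF linS, THEN iffD2], intro allI impI)
    fix x assume "S x = 0"
    with below[of x] t show "x = 0" by (simp add: mult_le_0_iff)
  qed
  have "\<exists>x. S x = y" for y
  proof -
    have "dist (y + Y u) (y + Y v) \<le> t * dist u v" for u v
      using Yt[of "u - v"] by (simp add: dist_norm linear_diff[OF Y(1)])
    \<comment> \<open>solving \<open>S x = y\<close> is a fixed point problem for the contraction \<open>x \<mapsto> y + Y x\<close>\<close>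
    then have "\<exists>!x. y + Y x = x" by (intro banach_fix_type[OF t]) blast
    then show ?thesis by (metis S_def add_diff_cancel_right')
  qed
  then have surjS: "surj S" by (metis surjI)
  define S' where "S' = inv S"
  have SS': "S (S' y) = y" for y using surjS by (simp add: S'_def surj_f_inv_f)
  have S'S: "S' (S x) = x" for x using injS by (simp add: S'_def)
  have linS': "linear S'"
    by (rule linearI; rule injD[OF injS])
       (simp_all add: SS' linear_add[OF linS] linear_scale[OF linS])
  have S'i: "S' (\<i> *\<^sub>C y) = \<i> *\<^sub>C S' y" for y
    using S'S[of "\<i> *\<^sub>C S' y"] by (simp add: Si SS')
  have boundS': "norm (S' y) \<le> norm y * (1 / (1 - t))" for y
    using below[of "S' y"] t by (simp add: SS' field_simps)
  have "bounded_linear S"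
    by (rule bounded_linear_intro[where K = 2])
       (use above in \<open>simp_all add: linear_add[OF linS] linear_scale[OF linS] mult.commute\<close>)
  then have "bounded_clinear S"
    unfolding bounded_clinear_def using linear_commute_i_imp_scaleC[of S, OF linS Si] by simp
  moreover have "bounded_linear S'"
    by (rule bounded_linear_intro[OF _ _ boundS'])
       (simp_all add: linear_add[OF linS'] linear_scale[OF linS'])
  then have "bounded_clinear S'"
    unfolding bounded_clinear_def using linear_commute_i_imp_scaleC[of S', OF linS' S'i] by simp
  moreover have "S' \<circ> S = id" "S \<circ> S' = id" using SS' S'S by auto
  ultimately have "inverse_operators S S'"
    unfolding inverse_operators_def by blast
  moreover have "onorm (S \<circ> T \<circ> S') \<le> 1"
  proof (rule onorm_bound)
    fix y
    have "(norm (S (T (S' y))))\<^sup>2 \<le> N (S' y) / M'"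
      unfolding normS using contr M'(1) by (simp add: divide_right_mono)
    also have "\<dots> = (norm y)\<^sup>2" by (simp add: normS[symmetric] SS')
    finally have "norm (S (T (S' y))) \<le> norm y" by (rule power2_le_imp_le) simp
    then show "norm ((S \<circ> T \<circ> S') y) \<le> 1 * norm y" by simp
  qed simp
  ultimately show ?thesis unfolding similar_to_contraction_def by blast
qed

section \<open>Toeplitz forms of operators\<close>

text \<open>A pair \<open>(n, f)\<close> stands for the polynomial \<open>p = \<Sum>k<n. z\<^sup>k f\<^sub>k\<close> with vector coefficients;
  \<open>op_eval\<close> is \<open>p(T) = \<Sum>k<n. T\<^sup>k f\<^sub>k\<close>.  All three functions recurse on \<open>p = f\<^sub>0 + z p'\<close>, so that
  the algebra below needs no manipulation of double sums.\<close>

primrec op_eval :: "('a::complex_inner \<Rightarrow> 'a) \<Rightarrow> nat \<Rightarrow> (nat \<Rightarrow> 'a) \<Rightarrow> 'a" where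
  "op_eval T 0 f = 0"
| "op_eval T (Suc n) f = f 0 + T (op_eval T n (\<lambda>k. f (Suc k)))"

text \<open>The quadratic form \<open>\<Sum>\<parallel>f\<^sub>k\<parallel>\<^sup>2 + 2 \<Sum>j<k. Re \<langle>T\<^sup>k\<^sup>-\<^sup>j f\<^sub>k, f\<^sub>j\<rangle>\<close> of the Toeplitz operator
  matrix built from the powers of \<open>T\<close>: the terms with \<open>j = 0\<close> are split off, and the rest is the
  same form for the shifted coefficients.\<close>

primrec toeplitz_form :: "('a::complex_inner \<Rightarrow> 'a) \<Rightarrow> nat \<Rightarrow> (nat \<Rightarrow> 'a) \<Rightarrow> real" where
  "toeplitz_form T 0 f = 0"
| "toeplitz_form T (Suc n) f = (norm (f 0))\<^sup>2
    + 2 * rinner (T (op_eval T n (\<lambda>k. f (Suc k)))) (f 0) + toeplitz_form T n (\<lambda>k. f (Suc k))"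

text \<open>The polynomial at \<open>e\<^sup>-\<^sup>i\<^sup>\<theta>\<close>; the sign matches the parametrisation of the curve.\<close>

primrec trig_poly :: "nat \<Rightarrow> (nat \<Rightarrow> 'a::complex_inner) \<Rightarrow> real \<Rightarrow> 'a" where
  "trig_poly 0 f \<theta> = 0"
| "trig_poly (Suc n) f \<theta> = f 0 + cis (- \<theta>) *\<^sub>C trig_poly n (\<lambda>k. f (Suc k)) \<theta>"

lemma op_eval_add:
  "linear T \<Longrightarrow> op_eval T n (\<lambda>k. f k + g k) = op_eval T n f + op_eval T n g"
  by (induction n arbitrary: f g) (simp_all add: linear_add)

lemma op_eval_diff:
  "linear T \<Longrightarrow> op_eval T n (\<lambda>k. f k - g k) = op_eval T n f - op_eval T n g"
  by (induction n arbitrary: f g) (simp_all add: linear_diff)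

lemma op_eval_scaleC:
  "bounded_clinear T \<Longrightarrow> op_eval T n (\<lambda>k. a *\<^sub>C f k) = a *\<^sub>C op_eval T n f"
  by (induction n arbitrary: f)
     (simp_all add: bounded_clinear_def scaleC_add_right scaleC_zero_right)

lemma trig_poly_add: "trig_poly n (\<lambda>k. f k + g k) \<theta> = trig_poly n f \<theta> + trig_poly n g \<theta>"
  by (induction n arbitrary: f g) (simp_all add: scaleC_add_right)

lemma trig_poly_diff: "trig_poly n (\<lambda>k. f k - g k) \<theta> = trig_poly n f \<theta> - trig_poly n g \<theta>"
  by (induction n arbitrary: f g) (simp_all add: scaleC_diff_right)

lemma trig_poly_scaleC: "trig_poly n (\<lambda>k. a *\<^sub>C f k) \<theta> = a *\<^sub>C trig_poly n f \<theta>"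
  by (induction n arbitrary: f)
     (simp_all add: scaleC_add_right scaleC_zero_right scaleC_scaleC mult.commute)

lemma toeplitz_form_parallelogram:
  assumes "linear T"
  shows "toeplitz_form T n (\<lambda>k. f k + g k) + toeplitz_form T n (\<lambda>k. f k - g k)
    = 2 * toeplitz_form T n f + 2 * toeplitz_form T n g"
proof (induction n arbitrary: f g)
  case (Suc n)
  show ?case
    using Suc.IH[of "\<lambda>k. f (Suc k)" "\<lambda>k. g (Suc k)"] parallelogram_norm[of "f 0" "g 0"]
    by (simp add: op_eval_add[OF assms] op_eval_diff[OF assms] linear_add[OF assms]
        linear_diff[OF assms] rinner_simps)
qed simp

lemma toeplitz_form_scaleC:
  assumes "bounded_clinear T"
  shows "toeplitz_form T n (\<lambda>k. a *\<^sub>C f k) = (cmod a)\<^sup>2 * toeplitz_form T n f"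
proof (induction n arbitrary: f)
  case (Suc n)
  have T: "T (a *\<^sub>C x) = a *\<^sub>C T x" for x using assms by (simp add: bounded_clinear_def)
  show ?case
    by (simp add: Suc.IH op_eval_scaleC[OF assms] T rinner_scaleC_both norm_scaleC
        power_mult_distrib algebra_simps)
qed simp

lemma op_eval_0: "linear T \<Longrightarrow> op_eval T n (\<lambda>k. 0) = 0"
  by (induction n) (simp_all add: linear_0)

lemma toeplitz_form_0: "linear T \<Longrightarrow> toeplitz_form T n (\<lambda>k. 0) = 0"
  by (induction n) (simp_all add: bounded_bilinear.zero_right[OF bounded_bilinear_rinner])

lemma trig_poly_0: "trig_poly n (\<lambda>k. 0) \<theta> = 0"
  by (induction n) (simp_all add: scaleC_zero_right)

text \<open>Zero coefficients change nothing, so two polynomials can be given a common length before they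
  are added.\<close>

lemma pad_zeros:
  assumes "linear T" "n \<le> m"
  shows "op_eval T m (\<lambda>k. if k < n then f k else 0) = op_eval T n f"
    and "toeplitz_form T m (\<lambda>k. if k < n then f k else 0) = toeplitz_form T n f"
    and "trig_poly m (\<lambda>k. if k < n then f k else 0) \<theta> = trig_poly n f \<theta>"
proof -
  have "op_eval T m (\<lambda>k. if k < n then f k else 0) = op_eval T n f \<and>
    toeplitz_form T m (\<lambda>k. if k < n then f k else 0) = toeplitz_form T n f \<and>
    trig_poly m (\<lambda>k. if k < n then f k else 0) \<theta> = trig_poly n f \<theta>"
    using \<open>n \<le> m\<close>
  proof (induction n arbitrary: m f)
    case 0
    then show ?case using assms(1) by (simp add: op_eval_0 toeplitz_form_0 trig_poly_0)
  next
    case (Suc n)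
    then obtain m' where "m = Suc m'" "n \<le> m'" by (cases m) auto
    then show ?case using Suc.IH[of m' "\<lambda>k. f (Suc k)"] by simp
  qed
  then show "op_eval T m (\<lambda>k. if k < n then f k else 0) = op_eval T n f"
    and "toeplitz_form T m (\<lambda>k. if k < n then f k else 0) = toeplitz_form T n f"
    and "trig_poly m (\<lambda>k. if k < n then f k else 0) \<theta> = trig_poly n f \<theta>"
    by auto
qed

text \<open>The linear term in \<open>y\<close> is exactly the pairing of \<open>y\<close> with \<open>p(T)\<close>.  This is how positivity of a
  Toeplitz form controls the norm of \<open>p(T)\<close>.\<close>

lemma subtract_constant:
  fixes f :: "nat \<Rightarrow> 'a::complex_inner"
  defines "g \<equiv> \<lambda>y k. if k = 0 then f 0 - y else f k"
  shows "toeplitz_form T (Suc n) (g y)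
      = toeplitz_form T (Suc n) f - 2 * rinner (op_eval T (Suc n) f) y + (norm y)\<^sup>2"
    and "trig_poly (Suc n) (g y) \<theta> = trig_poly (Suc n) f \<theta> - y"
  by (simp_all add: g_def norm_diff_sq rinner_simps rinner_commute)

text \<open>Multiplication by \<open>z\<close> acts as \<open>T\<close> on \<open>p(T)\<close> and preserves both the Toeplitz form and the
  boundary norm.\<close>

lemma shift_coefficients:
  "op_eval T (Suc n) (case_nat 0 f) = T (op_eval T n f)"
  "toeplitz_form T (Suc n) (case_nat 0 f) = toeplitz_form T n f"
  "norm (trig_poly (Suc n) (case_nat 0 f) \<theta>) = norm (trig_poly n f \<theta>)"
  by (simp_all add: norm_scaleC bounded_bilinear.zero_right[OF bounded_bilinear_rinner])

lemma norm_trig_poly_le: "norm (trig_poly n f \<theta>) \<le> (\<Sum>k<n. norm (f k))"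
proof (induction n arbitrary: f)
  case (Suc n)
  have "norm (trig_poly (Suc n) f \<theta>) \<le> norm (f 0) + norm (trig_poly n (\<lambda>k. f (Suc k)) \<theta>)"
    using norm_triangle_ineq[of "f 0" "cis (- \<theta>) *\<^sub>C trig_poly n (\<lambda>k. f (Suc k)) \<theta>"]
    by (simp add: norm_scaleC)
  also have "\<dots> \<le> norm (f 0) + (\<Sum>k<n. norm (f (Suc k)))" using Suc.IH by simp
  also have "\<dots> = (\<Sum>k<Suc n. norm (f k))" by (simp add: sum.lessThan_Suc_shift del: sum.lessThan_Suc)
  finally show ?case .
qed simp

lemma continuous_trig_poly: "continuous_on S (trig_poly n f)"
proof (induction n arbitrary: f)
  case 0
  then show ?case by (simp add: continuous_on_def)
next
  case (Suc n)
  have "continuous_on S (\<lambda>\<theta>. f 0 + cis (- \<theta>) *\<^sub>C trig_poly n (\<lambda>k. f (Suc k)) \<theta>)"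
    by (intro continuous_intros bounded_bilinear.continuous_on[OF bounded_bilinear_scaleC] Suc.IH)
  then show ?case by (simp add: continuous_on_cong[of S S "trig_poly (Suc n) f"])
qed

lemma integrable_weight_trig_poly:
  assumes "integrable lborel w"
  shows "integrable lborel (\<lambda>\<theta>. w \<theta> * (norm (trig_poly n f \<theta>))\<^sup>2)"
proof (rule Bochner_Integration.integrable_bound)
  define K where "K = (\<Sum>k<n. norm (f k))\<^sup>2"
  show "integrable lborel (\<lambda>\<theta>. K * w \<theta>)" using assms by simp
  have "(\<lambda>\<theta>. (norm (trig_poly n f \<theta>))\<^sup>2) \<in> borel_measurable borel"
    by (intro borel_measurable_continuous_onI continuous_intros continuous_trig_poly)
  moreover have "w \<in> borel_measurable lborel" using assms by blast
  ultimately show "(\<lambda>\<theta>. w \<theta> * (norm (trig_poly n f \<theta>))\<^sup>2) \<in> borel_measurable lborel"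
    by (intro borel_measurable_times) auto
  have "\<bar>w \<theta>\<bar> * (norm (trig_poly n f \<theta>))\<^sup>2 \<le> \<bar>w \<theta>\<bar> * K" for \<theta>
    unfolding K_def by (intro mult_left_mono power_mono norm_trig_poly_le) auto
  then show "AE \<theta> in lborel. norm (w \<theta> * (norm (trig_poly n f \<theta>))\<^sup>2) \<le> norm (K * w \<theta>)"
    by (auto simp: abs_mult K_def mult.commute)
qed

text \<open>The weighted term is counted twice in the form \<open>q\<close>: one copy restores positivity, and the
  other absorbs the weighted term of \<open>p - y\<close> when a constant \<open>y\<close> is subtracted.  The infimum of \<open>q\<close>
  over the polynomials with \<open>p(T) = x\<close> is then the required norm.\<close>

theorem similar_to_contraction_if_toeplitz_form_bounded_below:
  fixes T :: "'a::complex_hilbert_space \<Rightarrow> 'a" and w :: "real \<Rightarrow> real"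
  assumes T: "bounded_clinear T" and w: "integrable lborel w" "\<And>\<theta>. 0 \<le> w \<theta>"
    and pos: "\<And>n f. 0 \<le> toeplitz_form T n f + (\<integral>\<theta>. w \<theta> * (norm (trig_poly n f \<theta>))\<^sup>2 \<partial>lborel)"
  shows "similar_to_contraction T"
proof -
  have lin: "linear T" using T by (simp add: bounded_clinear_def bounded_linear.linear)
  define W where "W n f = (\<integral>\<theta>. w \<theta> * (norm (trig_poly n f \<theta>))\<^sup>2 \<partial>lborel)"
    for n and f :: "nat \<Rightarrow> 'a"
  define c where "c = integral\<^sup>L lborel w"
  define q where "q n f = toeplitz_form T n f + 2 * W n f" for n f
  note int = integrable_weight_trig_poly[OF w(1)]
  have c: "0 \<le> c" unfolding c_def by (simp add: w(2))
  have W0: "0 \<le> W n f" for n f unfolding W_def by (simp add: w(2))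
  have Wpar: "W n (\<lambda>k. f k + g k) + W n (\<lambda>k. f k - g k) = 2 * W n f + 2 * W n g" for n f g
  proof -
    have "W n (\<lambda>k. f k + g k) + W n (\<lambda>k. f k - g k)
        = (\<integral>\<theta>. w \<theta> * (norm (trig_poly n (\<lambda>k. f k + g k) \<theta>))\<^sup>2
              + w \<theta> * (norm (trig_poly n (\<lambda>k. f k - g k) \<theta>))\<^sup>2 \<partial>lborel)"
      unfolding W_def by (rule Bochner_Integration.integral_add[symmetric]) (rule int)+
    also have "\<dots> = (\<integral>\<theta>. 2 * (w \<theta> * (norm (trig_poly n f \<theta>))\<^sup>2)
        + 2 * (w \<theta> * (norm (trig_poly n g \<theta>))\<^sup>2) \<partial>lborel)"
    proof (rule Bochner_Integration.integral_cong[OF refl])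
      fix \<theta>
      show "w \<theta> * (norm (trig_poly n (\<lambda>k. f k + g k) \<theta>))\<^sup>2 + w \<theta> * (norm (trig_poly n (\<lambda>k. f k - g k) \<theta>))\<^sup>2
        = 2 * (w \<theta> * (norm (trig_poly n f \<theta>))\<^sup>2) + 2 * (w \<theta> * (norm (trig_poly n g \<theta>))\<^sup>2)"
        using arg_cong[OF parallelogram_norm[of "trig_poly n f \<theta>" "trig_poly n g \<theta>"], of "\<lambda>s. w \<theta> * s"]
        by (simp add: trig_poly_add trig_poly_diff algebra_simps)
    qed
    also have "\<dots> = 2 * W n f + 2 * W n g"
      unfolding W_def by (subst Bochner_Integration.integral_add) (simp_all add: int)
    finally show ?thesis .
  qed
  have qpar: "q n (\<lambda>k. f k + g k) + q n (\<lambda>k. f k - g k) = 2 * q n f + 2 * q n g" for n f g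
    using Wpar[of n f g] toeplitz_form_parallelogram[OF lin, of n f g] by (simp add: q_def)
  have qscale: "q n (\<lambda>k. a *\<^sub>C f k) = (cmod a)\<^sup>2 * q n f" for n a f
  proof -
    have "W n (\<lambda>k. a *\<^sub>C f k) = (\<integral>\<theta>. (cmod a)\<^sup>2 * (w \<theta> * (norm (trig_poly n f \<theta>))\<^sup>2) \<partial>lborel)"
      unfolding W_def by (simp add: trig_poly_scaleC norm_scaleC power_mult_distrib mult_ac)
    then have "W n (\<lambda>k. a *\<^sub>C f k) = (cmod a)\<^sup>2 * W n f"
      unfolding W_def by (simp only: integral_mult_right_zero)
    then show ?thesis
      by (simp add: q_def toeplitz_form_scaleC[OF T] algebra_simps)
  qed
  have qpad: "q m (\<lambda>k. if k < n then f k else 0) = q n f" if "n \<le> m" for m n f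
    by (simp only: q_def W_def pad_zeros[OF lin that])
  have q_const: "q 1 (\<lambda>k. x) = (1 + 2 * c) * (norm x)\<^sup>2" for x
    using w(1) by (simp add: q_def W_def c_def op_eval_0 linear_0[OF lin] scaleC_zero_right algebra_simps
        bounded_bilinear.zero_left[OF bounded_bilinear_rinner])
  have q_lower: "(norm (op_eval T n f))\<^sup>2 \<le> (1 + 2 * c) * q n f" for n f
  proof (cases n)
    case 0
    then show ?thesis by (simp add: q_def W_def)
  next
    case (Suc n')
    \<comment> \<open>optimal multiple of \<open>f(T)\<close> to subtract from the constant coefficient\<close>
    define y where "y = (1 / (1 + 2 * c)) *\<^sub>R op_eval T n f"
    define g where "g k = (if k = 0 then f 0 - y else f k)" for k
    have g: "toeplitz_form T n g = toeplitz_form T n f - 2 * rinner (op_eval T n f) y + (norm y)\<^sup>2"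
      "\<And>\<theta>. trig_poly n g \<theta> = trig_poly n f \<theta> - y"
      unfolding g_def Suc by (rule subtract_constant)+
    have "W n g \<le> (\<integral>\<theta>. 2 * (w \<theta> * (norm (trig_poly n f \<theta>))\<^sup>2) + 2 * (norm y)\<^sup>2 * w \<theta> \<partial>lborel)"
      unfolding W_def
    proof (rule integral_mono[OF int])
      show "integrable lborel (\<lambda>\<theta>. 2 * (w \<theta> * (norm (trig_poly n f \<theta>))\<^sup>2) + 2 * (norm y)\<^sup>2 * w \<theta>)"
        by (intro Bochner_Integration.integrable_add integrable_mult_right int w(1))
      fix \<theta>
      have "(norm (trig_poly n g \<theta>))\<^sup>2 \<le> 2 * (norm (trig_poly n f \<theta>))\<^sup>2 + 2 * (norm y)\<^sup>2"
        using parallelogram_norm[of "trig_poly n f \<theta>" y] zero_le_power2[of "norm (trig_poly n f \<theta> + y)"]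
        unfolding g by linarith
      from mult_left_mono[OF this w(2)[of \<theta>]]
      show "w \<theta> * (norm (trig_poly n g \<theta>))\<^sup>2
          \<le> 2 * (w \<theta> * (norm (trig_poly n f \<theta>))\<^sup>2) + 2 * (norm y)\<^sup>2 * w \<theta>"
        by (simp add: algebra_simps)
    qed
    also have "\<dots> = 2 * W n f + 2 * (norm y)\<^sup>2 * c"
      unfolding W_def c_def by (subst Bochner_Integration.integral_add) (simp_all add: int w(1))
    finally have "0 \<le> toeplitz_form T n g + (2 * W n f + 2 * (norm y)\<^sup>2 * c)"
      using pos[of n g] by (simp add: W_def)
    then have "2 * rinner (op_eval T n f) y - (1 + 2 * c) * (norm y)\<^sup>2 \<le> q n f"
      by (simp add: g q_def algebra_simps)
    moreover have "2 * rinner (op_eval T n f) y - (1 + 2 * c) * (norm y)\<^sup>2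
        = (norm (op_eval T n f))\<^sup>2 / (1 + 2 * c)"
    proof -
      define s where "s = 1 + 2 * c"
      have "0 < s" using c by (simp add: s_def)
      then show ?thesis unfolding y_def s_def[symmetric]
        by (simp add: rinner_simps rinner_self power_mult_distrib) (simp add: power2_eq_square field_simps)
    qed
    ultimately have "(norm (op_eval T n f))\<^sup>2 / (1 + 2 * c) \<le> q n f" by simp
    then show ?thesis using c by (simp add: pos_divide_le_eq mult.commute)
  qed
  have q0: "0 \<le> q n f" for n f
    using order_trans[OF zero_le_power2 q_lower[of n f]] c by (simp add: zero_le_mult_iff)
  define V where "V x = {q n f | n f. op_eval T n f = x}" for x
  define N where "N x = Inf (V x)" for x
  have V_const: "(1 + 2 * c) * (norm x)\<^sup>2 \<in> V x" for x
    unfolding V_def using q_const[of x]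
    by (intro CollectI exI[of _ 1] exI[of _ "\<lambda>k. x"]) (simp add: linear_0[OF lin])
  have V_bdd: "bdd_below (V x)" for x
    using q0 by (auto simp: V_def intro!: bdd_belowI[of _ 0])
  have N_le: "N (op_eval T n f) \<le> q n f" for n f
    unfolding N_def by (rule cInf_lower[OF _ V_bdd]) (auto simp: V_def)
  have N_ge: "b \<le> N x" if "\<And>n f. op_eval T n f = x \<Longrightarrow> b \<le> q n f" for b x
    unfolding N_def
  proof (rule cInf_greatest)
    show "V x \<noteq> {}" using V_const by blast
  qed (use that in \<open>auto simp: V_def\<close>)
  have N_near: "\<exists>n f. op_eval T n f = x \<and> q n f < N x + e" if "0 < e" for x e
    using cInf_lessD[of "V x" "N x + e"] V_const[of x] that by (auto simp: N_def V_def)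
  have N_scale: "N (a *\<^sub>C x) \<le> (cmod a)\<^sup>2 * N x" for a x
  proof (rule field_le_epsilon)
    fix e :: real assume e: "0 < e"
    define d where "d = e / ((cmod a)\<^sup>2 + 1)"
    have d: "0 < d" "(cmod a)\<^sup>2 * d \<le> e"
    proof -
      have "0 < (cmod a)\<^sup>2 + 1" by (simp add: add_nonneg_pos)
      then show "0 < d" "(cmod a)\<^sup>2 * d \<le> e" using e by (auto simp: d_def field_simps)
    qed
    obtain n f where f: "op_eval T n f = x" "q n f < N x + d" using N_near[OF d(1)] by blast
    have "N (a *\<^sub>C x) \<le> q n (\<lambda>k. a *\<^sub>C f k)"
      using N_le[of n "\<lambda>k. a *\<^sub>C f k"] f(1) by (simp add: op_eval_scaleC[OF T])
    also have "\<dots> \<le> (cmod a)\<^sup>2 * (N x + d)" unfolding qscale using f(2) by (simp add: mult_left_mono)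
    also have "\<dots> \<le> (cmod a)\<^sup>2 * N x + e" using d(2) by (simp add: distrib_left)
    finally show "N (a *\<^sub>C x) \<le> (cmod a)\<^sup>2 * N x + e" .
  qed
  have N_par_le: "N (x + y) + N (x - y) \<le> 2 * N x + 2 * N y" for x y
  proof (rule field_le_epsilon)
    fix e :: real assume e: "0 < e"
    obtain n f where f: "op_eval T n f = x" "q n f < N x + e / 4" using N_near[of "e/4" x] e by auto
    obtain m g where g: "op_eval T m g = y" "q m g < N y + e / 4" using N_near[of "e/4" y] e by auto
    define l where "l = max n m"
    define f' where "f' k = (if k < n then f k else 0)" for k
    define g' where "g' k = (if k < m then g k else 0)" for k
    have f': "op_eval T l f' = x" "q l f' = q n f"
      unfolding f'_def using pad_zeros(1)[OF lin, of n l f] qpad[of n l f] f(1) by (auto simp: l_def)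
    have g': "op_eval T l g' = y" "q l g' = q m g"
      unfolding g'_def using pad_zeros(1)[OF lin, of m l g] qpad[of m l g] g(1) by (auto simp: l_def)
    have "N (x + y) + N (x - y) \<le> q l (\<lambda>k. f' k + g' k) + q l (\<lambda>k. f' k - g' k)"
      using N_le[of l "\<lambda>k. f' k + g' k"] N_le[of l "\<lambda>k. f' k - g' k"]
      by (simp add: op_eval_add[OF lin] op_eval_diff[OF lin] f' g')
    also have "\<dots> = 2 * q n f + 2 * q m g" by (simp add: qpar f' g')
    finally show "N (x + y) + N (x - y) \<le> 2 * N x + 2 * N y + e" using f(2) g(2) by linarith
  qed
  show ?thesis
  proof (rule similar_to_contraction_if_hilbertian_norm[where N = N and m = "1 / (1 + 2 * c)" and M = "1 + 2 * c"])
    fix x y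
    \<comment> \<open>the reverse inequality is \<open>N_par_le\<close> at \<open>(x + y, x - y)\<close>, once \<open>N\<close> is known to be quadratic\<close>
    have half: "4 * N z \<le> N (z + z)" for z
    proof -
      have "(1/2) *\<^sub>C (z + z) = z"
        using scaleC_of_real[of "1/2" "z + z"] by (simp flip: scaleR_2)
      then show ?thesis using N_scale[of "1/2" "z + z"] by (simp add: power2_eq_square)
    qed
    have "N (x + x) + N (y + y) \<le> 2 * N (x + y) + 2 * N (x - y)"
      using N_par_le[of "x + y" "x - y"] by (simp add: algebra_simps)
    then show "N (x + y) + N (x - y) = 2 * N x + 2 * N y"
      using half[of x] half[of y] N_par_le[of x y] by linarith
    have "N x = N (- \<i> *\<^sub>C (\<i> *\<^sub>C x))" by (simp add: scaleC_scaleC scaleC_one)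
    also have "\<dots> \<le> N (\<i> *\<^sub>C x)" using N_scale[of "- \<i>" "\<i> *\<^sub>C x"] by simp
    finally show "N (\<i> *\<^sub>C x) = N x" using N_scale[of \<i> x] by simp
    show "1 / (1 + 2 * c) * (norm x)\<^sup>2 \<le> N x"
      by (rule N_ge) (use q_lower c in \<open>auto simp: field_simps\<close>)
    show "N x \<le> (1 + 2 * c) * (norm x)\<^sup>2"
      unfolding N_def by (rule cInf_lower[OF V_const V_bdd])
    show "0 < 1 / (1 + 2 * c)" using c by simp
    show "N (T x) \<le> N x"
    proof (rule N_ge)
      fix n f assume f: "op_eval T n f = x"
      have "q (Suc n) (case_nat 0 f) = q n f"
        by (simp only: q_def W_def shift_coefficients)
      then show "N (T x) \<le> q n f"
        using N_le[of "Suc n" "case_nat 0 f"] unfolding shift_coefficients f by simp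
    qed
  qed
qed

section \<open>Toeplitz forms as Poisson integrals of the resolvent\<close>

lemma resolvent_inverse:
  assumes "z \<notin> spectrum T"
  shows "bounded_linear (resolvent T z)"
    and "resolvent T z (z *\<^sub>C x - T x) = x"
    and "z *\<^sub>C resolvent T z x - T (resolvent T z x) = x"
proof -
  obtain R where R: "inverse_operators (\<lambda>x. z *\<^sub>C x - T x) R"
    using assms by (auto simp: spectrum_def)
  then have l: "R (z *\<^sub>C x - T x) = x" and r: "z *\<^sub>C R x - T (R x) = x" for x
    by (auto simp: inverse_operators_def fun_eq_iff)
  have "resolvent T z = R"
    unfolding resolvent_def by (rule inv_equality) (use l r in auto)
  then show "bounded_linear (resolvent T z)" "resolvent T z (z *\<^sub>C x - T x) = x"
    "z *\<^sub>C resolvent T z x - T (resolvent T z x) = x"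
    using R l r by (auto simp: inverse_operators_def bounded_clinear_def)
qed

lemma norm_resolvent_le:
  assumes "z \<notin> spectrum T"
  shows "norm (resolvent T z x) \<le> onorm (resolvent T z) * norm x"
  by (rule onorm[OF resolvent_inverse(1)[OF assms]])

text \<open>\<open>Q z\<close> is the inverse of \<open>1 - z T\<close>.  Passing from the resolvent at \<open>\<lambda>\<close> to \<open>z = 1 / \<lambda>\<close> moves the
  exterior of the disk to the disk, where Cauchy's theorem applies; the norm bound is the Kreiss
  condition in this variable.\<close>

locale kreiss_family =
  fixes T :: "'a::complex_hilbert_space \<Rightarrow> 'a" and Q :: "complex \<Rightarrow> 'a \<Rightarrow> 'a" and C :: real
  assumes T: "bounded_clinear T" and C: "0 \<le> C"
    and Q_left: "cmod z < 1 \<Longrightarrow> Q z (x - z *\<^sub>C T x) = x"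
    and Q_right: "cmod z < 1 \<Longrightarrow> Q z x - z *\<^sub>C T (Q z x) = x"
    and Q_bound: "cmod z < 1 \<Longrightarrow> norm (Q z x) \<le> C / (1 - cmod z) * norm x"
begin

lemma bounded_linear_T: "bounded_linear T" and T_scaleC: "T (a *\<^sub>C x) = a *\<^sub>C T x"
  using T by (auto simp: bounded_clinear_def)

lemmas linear_T = bounded_linear.linear[OF bounded_linear_T]
lemmas T_add = linear_add[OF linear_T]

lemma Q_unique: "cmod z < 1 \<Longrightarrow> u - z *\<^sub>C T u = x \<Longrightarrow> Q z x = u"
  using Q_left by metis

lemma Q_add: "cmod z < 1 \<Longrightarrow> Q z (x + y) = Q z x + Q z y"
  by (rule Q_unique) (simp_all add: T_add scaleC_add_right Q_right add_diff_add)

lemma Q_scaleC: "cmod z < 1 \<Longrightarrow> Q z (a *\<^sub>C x) = a *\<^sub>C Q z x"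
proof (rule Q_unique)
  assume z: "cmod z < 1"
  have "a *\<^sub>C Q z x - z *\<^sub>C T (a *\<^sub>C Q z x) = a *\<^sub>C (Q z x - z *\<^sub>C T (Q z x))"
    by (simp add: T_scaleC scaleC_diff_right scaleC_scaleC mult.commute)
  then show "a *\<^sub>C Q z x - z *\<^sub>C T (a *\<^sub>C Q z x) = a *\<^sub>C x" using z by (simp add: Q_right)
qed

lemma Q_recursion: "cmod z < 1 \<Longrightarrow> Q z x = x + z *\<^sub>C Q z (T x)"
proof (rule Q_unique)
  assume z: "cmod z < 1"
  have "z *\<^sub>C Q z (T x) - z *\<^sub>C T (z *\<^sub>C Q z (T x)) = z *\<^sub>C (Q z (T x) - z *\<^sub>C T (Q z (T x)))"
    by (simp add: T_scaleC scaleC_diff_right)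
  then have "z *\<^sub>C Q z (T x) - z *\<^sub>C T (z *\<^sub>C Q z (T x)) = z *\<^sub>C T x" using z by (simp add: Q_right)
  then show "x + z *\<^sub>C Q z (T x) - z *\<^sub>C T (x + z *\<^sub>C Q z (T x)) = x"
    by (simp add: T_add scaleC_add_right algebra_simps)
qed

text \<open>A form of the resolvent identity; it gives continuity in \<open>z\<close> and then the derivative.\<close>

lemma Q_diff: "cmod z < 1 \<Longrightarrow> cmod w < 1 \<Longrightarrow> Q w x - Q z x = (w - z) *\<^sub>C Q w (T (Q z x))"
proof -
  assume z: "cmod z < 1" and w: "cmod w < 1"
  have "Q w (Q z x - w *\<^sub>C T (Q z x)) = Q z x" by (rule Q_left[OF w])
  moreover have "Q z x - w *\<^sub>C T (Q z x) = x + (z - w) *\<^sub>C T (Q z x)"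
    using Q_right[OF z, of x] by (simp add: scaleC_diff_left algebra_simps)
  ultimately have "Q w x + (z - w) *\<^sub>C Q w (T (Q z x)) = Q z x"
    using w by (simp add: Q_add Q_scaleC)
  then show ?thesis by (simp add: scaleC_diff_left algebra_simps)
qed

lemma tendsto_Q:
  assumes z: "cmod z < 1"
  shows "((\<lambda>w. Q w x) \<longlongrightarrow> Q z x) (at z)"
proof -
  define K where "K = C / ((1 - cmod z) / 2) * norm (T (Q z x))"
  have lim: "((\<lambda>w. cmod (w - z) * K) \<longlongrightarrow> 0) (at z)"
    by (rule tendsto_eq_intros refl tendsto_mult_left_zero)+ auto
  have "\<forall>\<^sub>F w in at z. w \<in> ball z ((1 - cmod z) / 2)"
    using z by (intro eventually_at_in_open' open_ball) simp_all
  then have "\<forall>\<^sub>F w in at z. norm (Q w x - Q z x) \<le> cmod (w - z) * K"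
  proof eventually_elim
    case (elim w)
    then have d: "cmod (w - z) < (1 - cmod z) / 2" by (simp add: dist_norm norm_minus_commute)
    then have w: "cmod w < 1" and w': "(1 - cmod z) / 2 \<le> 1 - cmod w"
      using norm_triangle_ineq2[of w z] z by auto
    have "norm (Q w (T (Q z x))) \<le> C / (1 - cmod w) * norm (T (Q z x))" by (rule Q_bound[OF w])
    also have "\<dots> \<le> K"
      unfolding K_def using C z w' by (intro mult_right_mono divide_left_mono mult_pos_pos) auto
    finally show ?case by (simp add: Q_diff[OF z w] norm_scaleC mult_left_mono)
  qed
  then have "((\<lambda>w. Q w x - Q z x) \<longlongrightarrow> 0) (at z)" by (rule Lim_null_comparison[OF _ lim])
  then show ?thesis by (rule LIM_zero_cancel)
qed

lemma holomorphic_matrix_entry: "(\<lambda>z. cinner (Q z x) y) holomorphic_on ball 0 1"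
proof (rule holomorphic_onI)
  fix z :: complex assume "z \<in> ball 0 1"
  then have z: "cmod z < 1" by simp
  have "((\<lambda>w. cinner (Q w (T (Q z x))) y) \<longlongrightarrow> cinner (Q z (T (Q z x))) y) (at z)"
    by (intro bounded_bilinear.tendsto[OF bounded_bilinear_cinner] tendsto_Q[OF z] tendsto_const)
  moreover have "\<forall>\<^sub>F w in at z. w \<in> ball 0 1"
    using z by (intro eventually_at_in_open' open_ball) simp_all
  then have "\<forall>\<^sub>F w in at z. cinner (Q w (T (Q z x))) y = (cinner (Q w x) y - cinner (Q z x) y) / (w - z)"
    using eventually_neq_at_within[of z z UNIV]
  proof eventually_elim
    case (elim w)
    have "cinner (Q w x) y - cinner (Q z x) y = cinner (Q w x - Q z x) y"
      by (simp add: bounded_bilinear.diff_left[OF bounded_bilinear_cinner])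
    then show ?case using elim by (simp add: Q_diff[OF z] cinner_scaleC_left)
  qed
  ultimately have "((\<lambda>w. (cinner (Q w x) y - cinner (Q z x) y) / (w - z)) \<longlongrightarrow> cinner (Q z (T (Q z x))) y) (at z)"
    by (simp add: filterlim_cong)
  then have "((\<lambda>z. cinner (Q z x) y) has_field_derivative cinner (Q z (T (Q z x))) y) (at z)"
    by (simp add: has_field_derivative_iff)
  then show "(\<lambda>z. cinner (Q z x) y) field_differentiable at z within ball 0 1"
    using field_differentiable_at_within field_differentiable_def by blast
qed

end

lemma has_integral_circle_analytic:
  assumes f: "f holomorphic_on ball 0 1" and s: "0 < s" "s < 1"
  shows "((\<lambda>t. cis t ^ Suc m * f (of_real s * cis t)) has_integral 0) {-pi..pi}"
proof -
  have "((\<lambda>z. f z * z ^ m) has_contour_integral 0) (part_circlepath 0 s (- pi) pi)"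
  proof (rule Cauchy_theorem_disc_simple)
    show "(\<lambda>z. f z * z ^ m) holomorphic_on ball 0 1" by (intro holomorphic_intros f)
    show "path_image (part_circlepath 0 s (- pi) pi) \<subseteq> ball 0 1"
      using path_image_part_circlepath_subset'[of s 0 "- pi" pi] s by auto
  qed (auto simp: exp_eq_polar complex_eq_iff)
  then have "((\<lambda>t. f (of_real s * cis t) * (of_real s * cis t) ^ m * of_real s * \<i> * cis t) has_integral 0) {-pi..pi}"
    by (subst (asm) has_contour_integral_part_circlepath_iff) auto
  from has_integral_mult_right[OF this, of "inverse (of_real s ^ Suc m * \<i>)"]
  show ?thesis using s by (simp add: power_mult_distrib field_simps)
qed

lemma has_integral_cis_power: "((\<lambda>t. cis (- t) ^ Suc m) has_integral 0) {-pi..pi}"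
proof -
  have "((\<lambda>t. cis t ^ Suc m * 1) has_integral 0) {-pi..pi}"
    using has_integral_circle_analytic[of "\<lambda>_. 1" "1/2" m] by simp
  then have "((cnj \<circ> (\<lambda>t. cis t ^ Suc m * 1)) has_integral cnj 0) {-pi..pi}"
    by (simp only: has_integral_cnj)
  then show ?thesis by (simp add: cis_cnj o_def)
qed

lemma has_integral_cis_trig_poly:
  "((\<lambda>t. cis (- t) ^ Suc m * cinner (trig_poly n f t) y) has_integral 0) {-pi..pi}"
proof (induction n arbitrary: m f)
  case 0
  then show ?case by (simp add: cinner_zero_left)
next
  case (Suc n)
  have "((\<lambda>t. cis (- t) ^ Suc m * cinner (f 0) y + cis (- t) ^ Suc (Suc m) * cinner (trig_poly n (\<lambda>k. f (Suc k)) t) y)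
      has_integral 0 * cinner (f 0) y + 0) {-pi..pi}"
    by (intro has_integral_add has_integral_mult_left has_integral_cis_power Suc.IH)
  then show ?case by (simp add: cinner_add_left cinner_scaleC_left algebra_simps)
qed

context kreiss_family
begin

context
  fixes s :: real
  assumes s: "0 < s" "s < 1"
begin

lemma on_circle: "cmod (of_real s * cis t) < 1"
  using s by (simp add: norm_mult)

lemma fourier_negative:
  "((\<lambda>t. cis t ^ Suc m * cinner (Q (of_real s * cis t) x) y) has_integral 0) {-pi..pi}"
  by (rule has_integral_circle_analytic[OF holomorphic_matrix_entry s])

text \<open>These are the Taylor coefficients of \<open>(1 - z T)\<^sup>-\<^sup>1 = \<Sum> z\<^sup>m T\<^sup>m\<close>.  Iterating
  \<open>Q z x = x + z Q z (T x)\<close> reduces every one of them to the vanishing of the negative ones, so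
  convergence of the series is never an issue.\<close>

lemma fourier_nonnegative:
  "((\<lambda>t. cis (- t) ^ m * cinner (Q (of_real s * cis t) x) y)
      has_integral (2 * pi * cinner (((\<lambda>v. s *\<^sub>R T v) ^^ m) x) y)) {-pi..pi}"
proof (induction m arbitrary: x)
  case 0
  have "((\<lambda>t. cinner x y + of_real s * (cis t ^ Suc 0 * cinner (Q (of_real s * cis t) (T x)) y))
      has_integral ((pi - (- pi)) *\<^sub>R cinner x y + of_real s * 0)) {-pi..pi}"
    using has_integral_const_real[of "cinner x y" "-pi" pi]
    by (intro has_integral_add has_integral_mult_right fourier_negative) simp
  moreover have "cinner (Q (of_real s * cis t) x) y
      = cinner x y + of_real s * (cis t ^ Suc 0 * cinner (Q (of_real s * cis t) (T x)) y)" for t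
    by (subst Q_recursion[OF on_circle]) (simp add: cinner_add_left cinner_scaleC_left mult_ac)
  ultimately show ?case by (simp add: scaleR_conv_of_real)
next
  case (Suc m)
  have "((\<lambda>t. cis (- t) ^ Suc m * cinner x y
        + of_real s * (cis (- t) ^ m * cinner (Q (of_real s * cis t) (T x)) y))
      has_integral (0 * cinner x y + of_real s * (2 * pi * cinner (((\<lambda>v. s *\<^sub>R T v) ^^ m) (T x)) y))) {-pi..pi}"
    by (intro has_integral_add has_integral_mult_right has_integral_mult_left has_integral_cis_power Suc.IH)
  moreover have "cis (- t) ^ Suc m * cinner (Q (of_real s * cis t) x) y = cis (- t) ^ Suc m * cinner x y
        + of_real s * (cis (- t) ^ m * cinner (Q (of_real s * cis t) (T x)) y)" for t
  proof -
    have "cis (- t) * cis t = 1" by (simp add: cis_mult)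
    then show ?thesis
      by (subst Q_recursion[OF on_circle]) (simp add: cinner_add_left cinner_scaleC_left algebra_simps)
  qed
  moreover have pow: "((\<lambda>v. s *\<^sub>R T v) ^^ Suc m) x = s *\<^sub>R ((\<lambda>v. s *\<^sub>R T v) ^^ m) (T x)"
  proof -
    have "((\<lambda>v. s *\<^sub>R T v) ^^ m) (s *\<^sub>R v) = s *\<^sub>R ((\<lambda>v. s *\<^sub>R T v) ^^ m) v" for v
      by (induction m) (simp_all add: linear_scale[OF linear_T])
    then show ?thesis by (simp only: funpow_Suc_right o_apply)
  qed
  ultimately show ?case unfolding pow by (simp add: cinner_scaleR_left mult_ac)
qed

lemma has_integral_resolvent_trig_poly:
  "((\<lambda>t. cis (- t) ^ m * cinner (Q (of_real s * cis t) (trig_poly n f t)) y)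
      has_integral (2 * pi * cinner (((\<lambda>v. s *\<^sub>R T v) ^^ m) (op_eval (\<lambda>v. s *\<^sub>R T v) n f)) y)) {-pi..pi}"
proof (induction n arbitrary: m f)
  case 0
  have "((\<lambda>v. s *\<^sub>R T v) ^^ m) 0 = 0" by (induction m) (simp_all add: linear_0[OF linear_T])
  moreover have "Q (of_real s * cis t) 0 = 0" for t
    using Q_unique[OF on_circle[of t], of 0 0] by (simp add: linear_0[OF linear_T] scaleC_zero_right)
  ultimately show ?case by (simp add: cinner_zero_left)
next
  case (Suc n)
  let ?S = "\<lambda>v. s *\<^sub>R T v" and ?g = "\<lambda>k. f (Suc k)"
  have "linear ?S" by (rule linear_compose_scale_right[OF linear_T])
  then have "linear (?S ^^ m)"
    by (induction m) (auto simp: id_def linear_ident intro: linear_compose)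
  then have "(?S ^^ m) (op_eval ?S (Suc n) f) = (?S ^^ m) (f 0) + (?S ^^ Suc m) (op_eval ?S n ?g)"
    by (simp only: op_eval.simps linear_add funpow_Suc_right o_apply)
  moreover have "((\<lambda>t. cis (- t) ^ m * cinner (Q (of_real s * cis t) (f 0)) y
        + cis (- t) ^ Suc m * cinner (Q (of_real s * cis t) (trig_poly n ?g t)) y)
      has_integral (2 * pi * cinner ((?S ^^ m) (f 0)) y + 2 * pi * cinner ((?S ^^ Suc m) (op_eval ?S n ?g)) y)) {-pi..pi}"
    by (intro has_integral_add fourier_nonnegative Suc.IH)
  moreover have "cis (- t) ^ m * cinner (Q (of_real s * cis t) (trig_poly (Suc n) f t)) y
      = cis (- t) ^ m * cinner (Q (of_real s * cis t) (f 0)) y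
        + cis (- t) ^ Suc m * cinner (Q (of_real s * cis t) (trig_poly n ?g t)) y" for t
    by (simp add: Q_add[OF on_circle] Q_scaleC[OF on_circle] cinner_add_left cinner_scaleC_left
        distrib_left)
  ultimately show ?case by (simp add: cinner_add_left algebra_simps)
qed

lemma has_integral_trig_poly_resolvent:
  "((\<lambda>t. cis t ^ Suc m * cinner (Q (of_real s * cis t) x) (trig_poly n f t)) has_integral 0) {-pi..pi}"
proof (induction n arbitrary: m f)
  case 0
  then show ?case by (simp add: cinner_zero_right)
next
  case (Suc n)
  have "((\<lambda>t. cis t ^ Suc m * cinner (Q (of_real s * cis t) x) (f 0)
        + cis t ^ Suc (Suc m) * cinner (Q (of_real s * cis t) x) (trig_poly n (\<lambda>k. f (Suc k)) t))
      has_integral 0 + 0) {-pi..pi}"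
    by (intro has_integral_add fourier_negative Suc.IH)
  then show ?case by (simp add: cinner_add_right cinner_scaleC_right cis_cnj algebra_simps)
qed

definition poisson_form :: "real \<Rightarrow> 'a \<Rightarrow> real"
  where "poisson_form t x = 2 * rinner (Q (of_real s * cis t) x) x - (norm x)\<^sup>2"

lemma poisson_form_add:
  "poisson_form t (x + cis (- t) *\<^sub>C p) = poisson_form t x + poisson_form t p
    + 2 * Re (cis (- t) * cinner (Q (of_real s * cis t) p) x)
    + 2 * Re (cis t * cinner (Q (of_real s * cis t) x) p)
    - 2 * Re (cis (- t) * cinner p x)"
proof -
  have "cis t * cis (- t) = 1" by (simp add: cis_mult)
  then have c: "cis t * (cis (- t) * u) = u" for u by (metis mult.assoc mult_1)
  have "rinner (Q (of_real s * cis t) (x + cis (- t) *\<^sub>C p)) (x + cis (- t) *\<^sub>C p)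
    = rinner (Q (of_real s * cis t) x) x + rinner (Q (of_real s * cis t) p) p
    + Re (cis (- t) * cinner (Q (of_real s * cis t) p) x)
    + Re (cis t * cinner (Q (of_real s * cis t) x) p)"
    by (simp add: Q_add[OF on_circle] Q_scaleC[OF on_circle] rinner_def cinner_add_left cinner_add_right
        cinner_scaleC_left cinner_scaleC_right cis_cnj distrib_left c del: times_complex.sel)
  moreover have "rinner x (cis (- t) *\<^sub>C p) = Re (cis (- t) * cinner p x)"
    by (subst rinner_commute) (simp add: rinner_def cinner_scaleC_left)
  ultimately show ?thesis
    by (simp add: poisson_form_def norm_add_sq norm_scaleC del: times_complex.sel)
qed

text \<open>Induction on \<open>p = x + z p'\<close>: of the three cross terms only the first has a nonzero mean, since
  the functions in the others have no constant Fourier coefficient.  The result is the Toeplitz form of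
  \<open>s T\<close>, as the circle has radius \<open>s\<close>.\<close>

lemma has_integral_poisson_form:
  "((\<lambda>t. poisson_form t (trig_poly n f t))
      has_integral (2 * pi * toeplitz_form (\<lambda>v. s *\<^sub>R T v) n f)) {-pi..pi}"
proof (induction n arbitrary: f)
  case 0
  have "Q (of_real s * cis t) 0 = 0" for t
    using Q_unique[OF on_circle[of t], of 0 0] by (simp add: linear_0[OF linear_T] scaleC_zero_right)
  then show ?case by (simp add: poisson_form_def bounded_bilinear.zero_right[OF bounded_bilinear_rinner])
next
  case (Suc n)
  let ?S = "\<lambda>v. s *\<^sub>R T v" and ?g = "\<lambda>k. f (Suc k)" and ?x = "f 0"
  have Re: "(h has_integral I) {-pi..pi} \<Longrightarrow> ((\<lambda>t. 2 * Re (h t)) has_integral 2 * Re I) {-pi..pi}" for h I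
    by (intro has_integral_mult_right has_integral_Re)
  have A: "((\<lambda>t. poisson_form t ?x) has_integral 2 * pi * (norm ?x)\<^sup>2) {-pi..pi}"
    using has_integral_diff[OF Re[OF fourier_nonnegative[of 0 ?x ?x]] has_integral_const_real[of "(norm ?x)\<^sup>2" "-pi" pi]]
    by (simp add: poisson_form_def rinner_def[symmetric] rinner_self cinner_self algebra_simps del: of_real_power)
  have B: "((\<lambda>t. 2 * Re (cis (- t) * cinner (Q (of_real s * cis t) (trig_poly n ?g t)) ?x))
      has_integral 4 * pi * rinner (?S (op_eval ?S n ?g)) ?x) {-pi..pi}"
    using Re[OF has_integral_resolvent_trig_poly[of 1 n ?g ?x]] by (simp add: rinner_def mult.assoc)
  have C: "((\<lambda>t. 2 * Re (cis t * cinner (Q (of_real s * cis t) ?x) (trig_poly n ?g t))) has_integral 0) {-pi..pi}"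
    using Re[OF has_integral_trig_poly_resolvent[of 0 ?x n ?g]] by simp
  have D: "((\<lambda>t. 2 * Re (cis (- t) * cinner (trig_poly n ?g t) ?x)) has_integral 0) {-pi..pi}"
    using Re[OF has_integral_cis_trig_poly[of 0 n ?g ?x]] by simp
  have "((\<lambda>t. poisson_form t (trig_poly (Suc n) f t)) has_integral
      (2 * pi * (norm ?x)\<^sup>2 + 2 * pi * toeplitz_form ?S n ?g
        + 4 * pi * rinner (?S (op_eval ?S n ?g)) ?x + 0 - 0)) {-pi..pi}"
    unfolding trig_poly.simps poisson_form_add
    by (intro has_integral_add has_integral_diff A B C D Suc.IH)
  then show ?case by (simp add: algebra_simps)
qed

end

lemma tendsto_op_eval:
  "((\<lambda>s. op_eval (\<lambda>v. s *\<^sub>R T v) n f) \<longlongrightarrow> op_eval T n f) (at_left 1)"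
proof (induction n arbitrary: f)
  case (Suc n)
  have "((\<lambda>s. f 0 + s *\<^sub>R T (op_eval (\<lambda>v. s *\<^sub>R T v) n (\<lambda>k. f (Suc k))))
      \<longlongrightarrow> f 0 + 1 *\<^sub>R T (op_eval T n (\<lambda>k. f (Suc k)))) (at_left 1)"
    by (intro tendsto_intros bounded_linear.tendsto[OF bounded_linear_T] Suc.IH)
  then show ?case by simp
qed simp

lemma tendsto_toeplitz_form:
  "((\<lambda>s. toeplitz_form (\<lambda>v. s *\<^sub>R T v) n f) \<longlongrightarrow> toeplitz_form T n f) (at_left 1)"
proof (induction n arbitrary: f)
  case (Suc n)
  let ?g = "\<lambda>k. f (Suc k)"
  have "((\<lambda>s. (norm (f 0))\<^sup>2 + 2 * rinner (s *\<^sub>R T (op_eval (\<lambda>v. s *\<^sub>R T v) n ?g)) (f 0)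
        + toeplitz_form (\<lambda>v. s *\<^sub>R T v) n ?g)
      \<longlongrightarrow> (norm (f 0))\<^sup>2 + 2 * rinner (1 *\<^sub>R T (op_eval T n ?g)) (f 0) + toeplitz_form T n ?g) (at_left 1)"
    by (intro tendsto_intros bounded_bilinear.tendsto[OF bounded_bilinear_rinner]
        bounded_linear.tendsto[OF bounded_linear_T] tendsto_op_eval Suc.IH)
  then show ?case by simp
qed simp

text \<open>Positivity of the Toeplitz form of \<open>T\<close> plus weight is the limit, as \<open>s\<close> tends to \<open>1\<close>, of
  the same statement for \<open>s T\<close>.  The angle \<open>0\<close> is a null set and is left out because the weight
  obtained from the curve is infinite there.\<close>

theorem similar_to_contraction_if_poisson_bounded_below:
  assumes w: "integrable lborel w" "\<And>\<theta>. 0 \<le> w \<theta>"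
    and "s0 < 1"
    and pos: "\<And>s \<theta> x. s0 < s \<Longrightarrow> 0 < s \<Longrightarrow> s < 1 \<Longrightarrow> \<theta> \<in> {-pi..pi} \<Longrightarrow> \<theta> \<noteq> 0 \<Longrightarrow>
      (norm x)\<^sup>2 \<le> 2 * rinner (Q (of_real s * cis \<theta>) x) x + w \<theta> * (norm x)\<^sup>2"
  shows "similar_to_contraction T"
proof (rule similar_to_contraction_if_toeplitz_form_bounded_below[OF T])
  define w' where "w' \<theta> = 1 / (2 * pi) * w \<theta>" for \<theta>
  show w': "integrable lborel w'" "\<And>\<theta>. 0 \<le> w' \<theta>" unfolding w'_def using w by auto
  fix n and f :: "nat \<Rightarrow> 'a"
  let ?I = "\<integral>\<theta>. w' \<theta> * (norm (trig_poly n f \<theta>))\<^sup>2 \<partial>lborel"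
  have lower: "0 \<le> toeplitz_form (\<lambda>v. s *\<^sub>R T v) n f + ?I" if s: "s0 < s" "0 < s" "s < 1" for s
  proof -
    let ?P = "\<lambda>\<theta>. w' \<theta> * (norm (trig_poly n f \<theta>))\<^sup>2"
    let ?R = "\<lambda>\<theta>. poisson_form s \<theta> (trig_poly n f \<theta>)"
    have int: "integrable lborel ?P" by (rule integrable_weight_trig_poly[OF w'(1)])
    have P: "(?P has_integral ?I) UNIV" by (rule has_integral_integral_lborel[OF int])
    then have Pi: "?P integrable_on {-pi..pi}"
      using integrable_on_subinterval[of ?P UNIV "-pi" pi] by (auto simp: has_integral_integrable)
    have "integral {-pi..pi} ?P \<le> integral UNIV ?P"
      by (rule integral_subset_le) (use Pi P w'(2) in \<open>auto simp: has_integral_integrable\<close>)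
    then have le: "integral {-pi..pi} ?P \<le> ?I" using P by (simp add: integral_unique)
    have "((\<lambda>\<theta>. ?R \<theta> + 2 * pi * ?P \<theta>) has_integral
        2 * pi * toeplitz_form (\<lambda>v. s *\<^sub>R T v) n f + 2 * pi * integral {-pi..pi} ?P) {-pi..pi}"
      by (intro has_integral_add has_integral_mult_right has_integral_poisson_form s(2,3)
          integrable_integral Pi)
    then have "((\<lambda>\<theta>. if \<theta> = 0 then 0 else ?R \<theta> + 2 * pi * ?P \<theta>) has_integral
        2 * pi * toeplitz_form (\<lambda>v. s *\<^sub>R T v) n f + 2 * pi * integral {-pi..pi} ?P) {-pi..pi}"
      by (rule has_integral_spike_finite[of "{0}", rotated 2]) auto
    then have "0 \<le> 2 * pi * toeplitz_form (\<lambda>v. s *\<^sub>R T v) n f + 2 * pi * integral {-pi..pi} ?P"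
    proof (rule has_integral_nonneg)
      fix \<theta> assume "\<theta> \<in> {-pi..pi}"
      then show "0 \<le> (if \<theta> = 0 then 0 else ?R \<theta> + 2 * pi * ?P \<theta>)"
        using pos[OF s, of \<theta> "trig_poly n f \<theta>"]
        by (auto simp: poisson_form_def[OF s(2,3)] w'_def)
    qed
    then have "0 \<le> toeplitz_form (\<lambda>v. s *\<^sub>R T v) n f + integral {-pi..pi} ?P"
      using pi_gt_zero by (simp add: distrib_left[symmetric] zero_le_mult_iff)
    with le show ?thesis by linarith
  qed
  have "\<forall>\<^sub>F s in at_left (1::real). max s0 0 < s \<and> s < 1"
    using \<open>s0 < 1\<close> eventually_at_left_field[of "\<lambda>s. max s0 0 < s \<and> s < 1" 1] by (auto intro!: exI[of _ "max s0 0"])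
  then have "\<forall>\<^sub>F s in at_left 1. 0 \<le> toeplitz_form (\<lambda>v. s *\<^sub>R T v) n f + ?I"
    by eventually_elim (auto intro: lower)
  moreover have "((\<lambda>s. toeplitz_form (\<lambda>v. s *\<^sub>R T v) n f + ?I) \<longlongrightarrow> toeplitz_form T n f + ?I) (at_left 1)"
    by (intro tendsto_intros tendsto_toeplitz_form)
  ultimately show "0 \<le> toeplitz_form T n f + ?I"
    using tendsto_lowerbound trivial_limit_at_left_real by blast
qed

end

section \<open>Lower bounds for the Poisson kernel\<close>

lemma norm_le_resolvent_bound:
  assumes "z \<notin> spectrum T" "onorm (resolvent T z) \<le> B"
  shows "norm y \<le> B * norm (z *\<^sub>C y - T y)"
proof -
  have "norm y \<le> onorm (resolvent T z) * norm (z *\<^sub>C y - T y)"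
    using norm_resolvent_le[OF assms(1), of "z *\<^sub>C y - T y"] resolvent_inverse(2)[OF assms(1)] by simp
  also have "\<dots> \<le> B * norm (z *\<^sub>C y - T y)" using assms(2) by (simp add: mult_right_mono)
  finally show ?thesis .
qed

text \<open>Expand the square of \<open>(\<rho>' \<omega> - T) y = (\<rho>' - \<rho>) \<omega> y + x\<close>.\<close>

lemma rinner_resolvent_lower_bound:
  fixes T :: "'a::complex_inner \<Rightarrow> 'a"
  assumes "cmod \<omega> = 1" and "0 \<le> m"
    and low: "m * norm y \<le> norm ((of_real \<rho>' * \<omega>) *\<^sub>C y - T y)"
    and x: "x = (of_real \<rho> * \<omega>) *\<^sub>C y - T y"
  shows "- ((norm x)\<^sup>2 + ((\<rho>' - \<rho>)\<^sup>2 - m\<^sup>2) * (norm y)\<^sup>2) \<le> 2 * (\<rho>' - \<rho>) * rinner (\<omega> *\<^sub>C y) x"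
proof -
  have "(of_real \<rho>' * \<omega>) *\<^sub>C y - T y = (\<rho>' - \<rho>) *\<^sub>R (\<omega> *\<^sub>C y) + x"
    by (simp add: x scaleC_of_real[symmetric] scaleC_scaleC scaleC_diff_left left_diff_distrib scaleC_one)
  then have "(norm ((of_real \<rho>' * \<omega>) *\<^sub>C y - T y))\<^sup>2
      = (\<rho>' - \<rho>)\<^sup>2 * (norm y)\<^sup>2 + 2 * (\<rho>' - \<rho>) * rinner (\<omega> *\<^sub>C y) x + (norm x)\<^sup>2"
    using assms(1) by (simp add: norm_add_sq rinner_simps norm_scaleC power_mult_distrib)
  moreover have "(m * norm y)\<^sup>2 \<le> (norm ((of_real \<rho>' * \<omega>) *\<^sub>C y - T y))\<^sup>2"
    using low \<open>0 \<le> m\<close> by (intro power_mono) auto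
  ultimately show ?thesis by (simp add: power_mult_distrib algebra_simps)
qed

text \<open>Here \<open>y\<close> is the resolvent at \<open>\<rho> \<omega>\<close> applied to \<open>x\<close>, and the assumption on \<open>norm y\<close> is the Kreiss
  bound.  Since \<open>(\<omega> - T) y\<close> differs from \<open>x\<close> by a vector of norm \<open>(\<rho> - 1) \<parallel>y\<parallel> \<le> C \<parallel>x\<parallel>\<close>, the
  resolvent just outside the circle is controlled by its boundary value.\<close>

lemma norm_resolvent_radial:
  assumes "cmod \<omega> = 1" and \<omega>: "\<omega> \<notin> spectrum T" and "1 < \<rho>"
    and x: "x = (of_real \<rho> * \<omega>) *\<^sub>C y - T y" and y: "norm y \<le> C / (\<rho> - 1) * norm x"
  shows "norm y \<le> (1 + C) * onorm (resolvent T \<omega>) * norm x"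
proof -
  let ?N = "onorm (resolvent T \<omega>)"
  have "\<omega> *\<^sub>C y - T y = x - (\<rho> - 1) *\<^sub>R (\<omega> *\<^sub>C y)"
    by (simp add: x scaleC_of_real[symmetric] scaleC_scaleC scaleC_diff_left left_diff_distrib scaleC_one)
  then have "norm (\<omega> *\<^sub>C y - T y) \<le> norm x + (\<rho> - 1) * norm y"
    using norm_triangle_ineq4[of x "(\<rho> - 1) *\<^sub>R (\<omega> *\<^sub>C y)"] assms(1,3) by (simp add: norm_scaleC)
  also have "\<dots> \<le> norm x + C * norm x"
    using mult_left_mono[OF y, of "\<rho> - 1"] \<open>1 < \<rho>\<close> by simp
  finally have "norm (\<omega> *\<^sub>C y - T y) \<le> (1 + C) * norm x" by (simp add: algebra_simps)
  then have "?N * norm (\<omega> *\<^sub>C y - T y) \<le> ?N * ((1 + C) * norm x)"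
    by (rule mult_left_mono) (rule onorm_pos_le[OF resolvent_inverse(1)[OF \<omega>]])
  with norm_le_resolvent_bound[OF \<omega> order_refl, of y] show ?thesis by (simp add: mult_ac)
qed

text \<open>If \<open>\<parallel>(z - T)\<^sup>-\<^sup>1\<parallel> < N\<close>, the resolvent is bounded by \<open>2 N\<close> at distance at most \<open>1 / (2 N)\<close> from
  \<open>z\<close>; finitely many such disks cover.\<close>

lemma resolvent_bounded_on_compact:
  assumes A: "compact A" "A \<inter> spectrum T = {}"
  obtains K where "\<And>z. z \<in> A \<Longrightarrow> onorm (resolvent T z) \<le> K"
proof -
  \<comment> \<open>the summand \<open>1\<close> makes \<open>N z\<close> positive also on the trivial space\<close>
  define N where "N z = onorm (resolvent T z) + 1" for z
  have N: "0 < N z" if "z \<in> A" for z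
  proof -
    have "z \<notin> spectrum T" using that A(2) by blast
    from onorm_pos_le[OF resolvent_inverse(1)[OF this]] show ?thesis by (simp add: N_def)
  qed
  have near: "onorm (resolvent T w) \<le> 2 * N z" if z: "z \<in> A" and w: "w \<in> A" and d: "cmod (z - w) \<le> 1 / (2 * N z)" for z w
  proof (rule onorm_bound)
    show "0 \<le> 2 * N z" using N[OF z] by simp
    fix x
    define y where "y = resolvent T w x"
    have "w \<notin> spectrum T" using w A(2) by blast
    from resolvent_inverse(3)[OF this, of x] have "z *\<^sub>C y - T y = x + (z - w) *\<^sub>C y"
      by (simp add: y_def[symmetric] scaleC_diff_left algebra_simps)
    then have "norm (z *\<^sub>C y - T y) \<le> norm x + 1 / (2 * N z) * norm y"
      using norm_triangle_ineq[of x "(z - w) *\<^sub>C y"] mult_right_mono[OF d, of "norm y"]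
      by (simp add: norm_scaleC)
    then have "N z * norm (z *\<^sub>C y - T y) \<le> N z * (norm x + 1 / (2 * N z) * norm y)"
      by (rule mult_left_mono) (use N[OF z] in simp)
    moreover have "norm y \<le> N z * norm (z *\<^sub>C y - T y)"
      by (rule norm_le_resolvent_bound) (use z A(2) in \<open>auto simp: N_def\<close>)
    ultimately have "norm y \<le> N z * norm x + norm y / 2"
      using N[OF z] by (simp add: distrib_left)
    then show "norm (resolvent T w x) \<le> 2 * N z * norm x" by (simp add: y_def)
  qed
  have "A \<subseteq> (\<Union>z\<in>A. ball z (1 / (2 * N z)))" using N by fastforce
  then obtain F where F: "F \<subseteq> A" "finite F" "A \<subseteq> (\<Union>z\<in>F. ball z (1 / (2 * N z)))"
    using compactE_image[OF A(1), of A "\<lambda>z. ball z (1 / (2 * N z))"] by auto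
  show thesis
  proof (rule that)
    fix w assume w: "w \<in> A"
    then obtain z where z: "z \<in> F" "cmod (z - w) < 1 / (2 * N z)"
      using F(3) by (auto simp: dist_norm)
    then have "onorm (resolvent T w) \<le> 2 * N z" using near F(1) w by auto
    also have "\<dots> \<le> (\<Sum>z\<in>F. 2 * N z)"
      by (rule member_le_sum) (use z F N in \<open>auto intro: less_imp_le\<close>)
    finally show "onorm (resolvent T w) \<le> (\<Sum>z\<in>F. 2 * N z)" .
  qed
qed

text \<open>The operator \<open>(1 - z T)\<^sup>-\<^sup>1\<close>, with its value \<open>1\<close> at \<open>z = 0\<close>.\<close>

definition reciprocal_resolvent :: "('a::complex_inner \<Rightarrow> 'a) \<Rightarrow> complex \<Rightarrow> 'a \<Rightarrow> 'a"
  where "reciprocal_resolvent T z x = (if z = 0 then x else (1 / z) *\<^sub>C resolvent T (1 / z) x)"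

lemma kreiss_family_reciprocal_resolvent:
  fixes T :: "'a::complex_hilbert_space \<Rightarrow> 'a"
  assumes T: "bounded_clinear T" and C: "1 \<le> C"
    and K: "\<And>z. 1 < cmod z \<Longrightarrow> z \<notin> spectrum T \<and> onorm (resolvent T z) \<le> C / (cmod z - 1)"
  shows "kreiss_family T (reciprocal_resolvent T) C"
proof
  show "bounded_clinear T" by (rule T)
  show "0 \<le> C" using C by simp
  fix z :: complex and x :: 'a assume z: "cmod z < 1"
  have Tl: "linear T" and Ts: "T (a *\<^sub>C v) = a *\<^sub>C T v" for a v
    using T by (auto simp: bounded_clinear_def bounded_linear.linear)
  have large: "1 < cmod (1 / z)" if "z \<noteq> 0" using z that by (simp add: norm_divide)
  show "reciprocal_resolvent T z (x - z *\<^sub>C T x) = x"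
  proof (cases "z = 0")
    case False
    have "(1 / z) *\<^sub>C (z *\<^sub>C x) - T (z *\<^sub>C x) = x - z *\<^sub>C T x"
      using False by (simp add: scaleC_scaleC scaleC_one Ts)
    then have "resolvent T (1 / z) (x - z *\<^sub>C T x) = z *\<^sub>C x"
      using resolvent_inverse(2)[of "1 / z" T "z *\<^sub>C x"] K[OF large[OF False]] by simp
    then show ?thesis using False by (simp add: reciprocal_resolvent_def scaleC_scaleC scaleC_one)
  qed (simp add: reciprocal_resolvent_def scaleC_zero_left)
  show "reciprocal_resolvent T z x - z *\<^sub>C T (reciprocal_resolvent T z x) = x"
  proof (cases "z = 0")
    case False
    then show ?thesis
      using resolvent_inverse(3)[of "1 / z" T x] K[OF large[OF False]]
      by (simp add: reciprocal_resolvent_def Ts scaleC_scaleC scaleC_one)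
  qed (simp add: reciprocal_resolvent_def scaleC_zero_left)
  show "norm (reciprocal_resolvent T z x) \<le> C / (1 - cmod z) * norm x"
  proof (cases "z = 0")
    case True
    then show ?thesis using mult_right_mono[OF C, of "norm x"] by (simp add: reciprocal_resolvent_def)
  next
    case False
    have "norm (resolvent T (1 / z) x) \<le> C / (cmod (1 / z) - 1) * norm x"
      by (rule order_trans[OF norm_resolvent_le mult_right_mono]) (use K[OF large[OF False]] in auto)
    then have "cmod (1 / z) * norm (resolvent T (1 / z) x)
        \<le> cmod (1 / z) * (C / (cmod (1 / z) - 1) * norm x)"
      by (rule mult_left_mono) simp
    also have "\<dots> = C / (1 - cmod z) * norm x"
      using False z by (simp add: norm_divide field_simps)
    finally show ?thesis using False by (simp add: reciprocal_resolvent_def norm_scaleC)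
  qed
qed

lemma v_type_curve_radius:
  assumes "v_type_curve \<delta>m \<delta>p \<gamma>"
  shows "0 < \<delta>m" "\<delta>m < pi" "0 < \<delta>p" "\<delta>p < pi" "1 < cmod (\<gamma> \<delta>p)"
    and "\<theta> \<in> {-\<delta>m..\<delta>p} \<Longrightarrow> \<theta> \<noteq> 0 \<Longrightarrow> 1 < cmod (\<gamma> \<theta>)"
    and "\<theta> \<in> {-\<delta>m..\<delta>p} \<Longrightarrow> 1 \<le> cmod (\<gamma> \<theta>)"
    and "\<theta> \<in> {-\<delta>m..\<delta>p} \<Longrightarrow> cmod (\<gamma> \<theta>) \<le> cmod (\<gamma> \<delta>p)"
    and "set_integrable lborel {-\<delta>m..\<delta>p} (\<lambda>\<theta>. 1 / (cmod (\<gamma> \<theta>) - 1))"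
proof -
  have \<delta>: "0 < \<delta>m" "\<delta>m < pi" "0 < \<delta>p" "\<delta>p < pi" using assms by (auto simp: v_type_curve_def)
  obtain r where r: "\<forall>\<theta>\<in>{-\<delta>m..\<delta>p}. 1 \<le> r \<theta> \<and> \<gamma> \<theta> = complex_of_real (r \<theta>) * cis (- \<theta>)"
    and mono: "strict_mono_on {0..\<delta>p} r" and anti: "strict_antimono_on {-\<delta>m..0} r"
    and ends: "r 0 = 1" "r (-\<delta>m) = r \<delta>p" "1 < r \<delta>p"
    and int: "set_integrable lborel {-\<delta>m..\<delta>p} (\<lambda>\<theta>. 1 / (r \<theta> - 1))"
    using assms unfolding v_type_curve_def by blast
  have cmod: "cmod (\<gamma> \<theta>) = r \<theta>" if "\<theta> \<in> {-\<delta>m..\<delta>p}" for \<theta>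
    using bspec[OF r that] by (simp add: norm_mult)
  show "0 < \<delta>m" "\<delta>m < pi" "0 < \<delta>p" "\<delta>p < pi" by fact+
  show "1 < cmod (\<gamma> \<delta>p)" using cmod[of \<delta>p] \<delta> ends by simp
  show "1 \<le> cmod (\<gamma> \<theta>)" if "\<theta> \<in> {-\<delta>m..\<delta>p}" using cmod r that by simp
  show "1 < cmod (\<gamma> \<theta>)" if \<theta>: "\<theta> \<in> {-\<delta>m..\<delta>p}" "\<theta> \<noteq> 0"
  proof (cases "0 < \<theta>")
    case True
    then have "r 0 < r \<theta>" using \<theta> by (intro strict_mono_onD[OF mono]) auto
    then show ?thesis using cmod[OF \<theta>(1)] ends by simp
  next
    case False
    then have "r 0 < r \<theta>" using \<theta> by (intro monotone_onD[OF anti]) auto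
    then show ?thesis using cmod[OF \<theta>(1)] ends by simp
  qed
  show "cmod (\<gamma> \<theta>) \<le> cmod (\<gamma> \<delta>p)" if \<theta>: "\<theta> \<in> {-\<delta>m..\<delta>p}"
  proof -
    have "r \<theta> \<le> r \<delta>p"
    proof (cases "0 \<le> \<theta>")
      case True
      then show ?thesis
        using \<theta> strict_mono_onD[OF mono, of \<theta> \<delta>p] by (cases "\<theta> = \<delta>p") auto
    next
      case False
      then show ?thesis
        using \<theta> monotone_onD[OF anti, of "-\<delta>m" \<theta>] ends by (cases "\<theta> = -\<delta>m") auto
    qed
    then show ?thesis using cmod[OF \<theta>] cmod[of \<delta>p] \<delta> by simp
  qed
  show "set_integrable lborel {-\<delta>m..\<delta>p} (\<lambda>\<theta>. 1 / (cmod (\<gamma> \<theta>) - 1))"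
    using int by (subst set_integrable_cong[of lborel lborel "{-\<delta>m..\<delta>p}" "{-\<delta>m..\<delta>p}" _ "\<lambda>\<theta>. 1 / (r \<theta> - 1)"])
      (auto simp: cmod)
qed

text \<open>Comparison with the point of the curve at the same angle, when \<open>\<rho>\<close> is at most halfway between
  \<open>1\<close> and \<open>r\<close>.  The defect \<open>(r - \<rho>)\<^sup>2 - ((r - 1) / (1 + e))\<^sup>2\<close> is at most \<open>2 e (r - 1)\<^sup>2\<close>, and
  division by \<open>r - \<rho> \<ge> (r - 1) / 2\<close> gives the constants.\<close>

lemma rinner_resolvent_from_curve:
  fixes T :: "'a::complex_inner \<Rightarrow> 'a"
  assumes \<omega>: "cmod \<omega> = 1" and \<rho>: "1 < \<rho>" "2 * (\<rho> - 1) \<le> r - 1" and e: "0 \<le> e"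
    and spec: "of_real r * \<omega> \<notin> spectrum T"
    and res: "onorm (resolvent T (of_real r * \<omega>)) \<le> (1 + e) / (r - 1)"
    and x: "x = (of_real \<rho> * \<omega>) *\<^sub>C y - T y"
  shows "- (2 / (r - 1) * (norm x)\<^sup>2 + 4 * e * (r - 1) * (norm y)\<^sup>2) \<le> 2 * rinner (\<omega> *\<^sub>C y) x"
proof -
  have r: "0 < r - 1" using \<rho> by simp
  define m where "m = (r - 1) / (1 + e)"
  define D where "D = r - \<rho>"
  have D: "(r - 1) / 2 \<le> D" "D \<le> r - 1" "0 < D" using \<rho> r by (auto simp: D_def)
  have m: "0 \<le> m" using r e by (simp add: m_def)
  have low: "m * norm y \<le> norm ((of_real r * \<omega>) *\<^sub>C y - T y)"
    using norm_le_resolvent_bound[OF spec res, of y] r e by (simp add: m_def field_simps)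
  have "(1 - 2 * e) * (r - 1)\<^sup>2 \<le> m\<^sup>2"
  proof -
    have "(1 - 2 * e) * (1 + e)\<^sup>2 \<le> 1"
      using e by (simp add: power2_eq_square algebra_simps)
    then have "(1 - 2 * e) \<le> 1 / (1 + e)\<^sup>2" using e by (simp add: pos_le_divide_eq)
    from mult_right_mono[OF this, of "(r - 1)\<^sup>2"] show ?thesis by (simp add: m_def power_divide)
  qed
  moreover have "D\<^sup>2 \<le> (r - 1)\<^sup>2" using D by (intro power_mono) auto
  ultimately have "D\<^sup>2 - m\<^sup>2 \<le> 2 * e * (r - 1)\<^sup>2" by (simp add: algebra_simps)
  from mult_right_mono[OF this, of "(norm y)\<^sup>2"]
  have main: "- ((norm x)\<^sup>2 + 2 * e * (r - 1)\<^sup>2 * (norm y)\<^sup>2) \<le> 2 * D * rinner (\<omega> *\<^sub>C y) x"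
    using rinner_resolvent_lower_bound[of \<omega> m y r T x \<rho>, OF \<omega> m low x] unfolding D_def by simp
  define S where "S = (norm x)\<^sup>2 + 2 * e * (r - 1)\<^sup>2 * (norm y)\<^sup>2"
  have S: "0 \<le> S" using e by (simp add: S_def)
  have "- S / D \<le> 2 * rinner (\<omega> *\<^sub>C y) x"
    using main[folded S_def] D(3) by (simp only: pos_divide_le_eq mult_ac)
  moreover have "S / D \<le> S / ((r - 1) / 2)" using D r S by (intro divide_left_mono) auto
  moreover have "S / ((r - 1) / 2) = 2 / (r - 1) * (norm x)\<^sup>2 + 4 * e * (r - 1) * (norm y)\<^sup>2"
    using r by (simp add: S_def power2_eq_square field_simps)
  ultimately show ?thesis by linarith
qed

text \<open>Comparison with the point twice as far from the circle.  As \<open>2 d / (1 + e) \<ge> d\<close>, the term with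
  \<open>norm y\<close> has the favourable sign and drops out.\<close>

lemma rinner_resolvent_doubled_distance:
  fixes T :: "'a::complex_inner \<Rightarrow> 'a"
  assumes \<omega>: "cmod \<omega> = 1" and d: "0 < d" and e: "0 \<le> e" "e \<le> 1"
    and spec: "of_real (1 + 2 * d) * \<omega> \<notin> spectrum T"
    and res: "onorm (resolvent T (of_real (1 + 2 * d) * \<omega>)) \<le> (1 + e) / (2 * d)"
    and x: "x = (of_real (1 + d) * \<omega>) *\<^sub>C y - T y"
  shows "- ((norm x)\<^sup>2 / d) \<le> 2 * rinner (\<omega> *\<^sub>C y) x"
proof -
  have "norm y \<le> (1 + e) / (2 * d) * norm ((of_real (1 + 2 * d) * \<omega>) *\<^sub>C y - T y)"
    by (rule norm_le_resolvent_bound[OF spec res])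
  also have "\<dots> \<le> 1 / d * norm ((of_real (1 + 2 * d) * \<omega>) *\<^sub>C y - T y)"
    using d e by (intro mult_right_mono) (auto simp: field_simps)
  finally have low: "d * norm y \<le> norm ((of_real (1 + 2 * d) * \<omega>) *\<^sub>C y - T y)"
    using d by (simp add: field_simps)
  show ?thesis
    using rinner_resolvent_lower_bound[of \<omega> d y "1 + 2 * d" T x "1 + d", OF \<omega> _ low x] d
    by (simp add: field_simps)
qed

theorem theorem1p5:
  fixes T :: "'a::complex_hilbert_space \<Rightarrow> 'a"
    and \<gamma> :: "real \<Rightarrow> complex" and r \<epsilon> :: "real \<Rightarrow> real" and \<delta>m \<delta>p \<nu> :: real
  assumes "bounded_clinear T"
    and "spectrum T \<subseteq> ball 0 1 \<union> {1}"
    and "v_type_curve \<delta>m \<delta>p \<gamma>"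
    and "r = (\<lambda>\<theta>. cmod (\<gamma> \<theta>))"
    and "Kreiss_condition T"
    and "r \<delta>p - 1 \<le> \<nu>"
    and "continuous_on {0<..\<nu>} \<epsilon>"
    and "mono_on {0<..\<nu>} \<epsilon>"
    and "\<forall>x\<in>{0<..\<nu>}. 0 < \<epsilon> x"
    and "(\<epsilon> \<longlongrightarrow> 0) (at_right 0)"
    and "\<forall>z\<in>v_type_set \<delta>m \<delta>p \<gamma>. z \<noteq> 1 \<longrightarrow>
           onorm (resolvent T z) \<le> (1 + \<epsilon> (cmod z - 1)) / (cmod z - 1)"
    and "set_integrable lborel {-\<delta>m..\<delta>p}
           (\<lambda>\<theta>. \<epsilon> (r \<theta> - 1) / (r \<theta> - 1) * (onorm (resolvent T (cis (- \<theta>))))\<^sup>2)"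
  shows "similar_to_contraction T"
proof -
  note curve = v_type_curve_radius[OF assms(3), folded fun_cong[OF assms(4)]]
  have r_def: "r \<theta> = cmod (\<gamma> \<theta>)" for \<theta> using assms(4) by simp
  note rad = curve[unfolded r_def[symmetric]]
  obtain C0 where C0: "\<And>z. 1 < cmod z \<Longrightarrow> z \<notin> spectrum T \<and> onorm (resolvent T z) \<le> C0 / (cmod z - 1)"
    using assms(5) unfolding Kreiss_condition_def by blast
  define C where "C = max C0 1"
  have C: "1 \<le> C" by (simp add: C_def)
  have K: "z \<notin> spectrum T \<and> onorm (resolvent T z) \<le> C / (cmod z - 1)" if "1 < cmod z" for z
  proof -
    have "C0 / (cmod z - 1) \<le> C / (cmod z - 1)" using that by (intro divide_right_mono) (auto simp: C_def)
    with C0[OF that] show ?thesis by auto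
  qed
  interpret kreiss_family T "reciprocal_resolvent T" C
    by (rule kreiss_family_reciprocal_resolvent[OF assms(1) C K])
  define L where "L = r \<delta>p - 1"
  have L: "0 < L" using rad(5) by (simp add: L_def)
  have circle: "cis (- \<theta>) \<notin> spectrum T" if "\<theta> \<in> {-pi..pi}" "\<theta> \<noteq> 0" for \<theta>
  proof -
    have "cos \<bar>\<theta>\<bar> < cos 0" by (rule cos_monotone_0_pi) (use that in auto)
    then have "cis (- \<theta>) \<noteq> 1" by (auto simp: complex_eq_iff)
    then show ?thesis using assms(2) by auto
  qed
  define A where "A = (\<lambda>\<theta>. cis (- \<theta>)) ` ({-pi..-\<delta>m} \<union> {\<delta>p..pi})"
  have "compact A" unfolding A_def
    by (intro compact_continuous_image continuous_intros compact_Un compact_Icc)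
  moreover have "A \<inter> spectrum T = {}"
    using circle rad(1-4) by (auto simp: A_def)
  ultimately obtain M0 where M0: "\<And>z. z \<in> A \<Longrightarrow> onorm (resolvent T z) \<le> M0"
    by (rule resolvent_bounded_on_compact) blast
  define M where "M = max M0 0"
  have M: "0 \<le> M" "\<And>z. z \<in> A \<Longrightarrow> onorm (resolvent T z) \<le> M"
    using M0 by (force simp: M_def)+
  have \<epsilon>: "0 \<le> \<epsilon> (r \<theta> - 1) / (r \<theta> - 1)" if "\<theta> \<in> {-\<delta>m..\<delta>p}" for \<theta>
  proof (cases "r \<theta> = 1")
    case False
    then have "r \<theta> - 1 \<in> {0<..\<nu>}" using rad(7,8)[OF that] assms(6) by auto
    then show ?thesis using assms(9) by (auto intro: less_imp_le)
  qed simp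
  have estimate: "of_real \<rho> * cis (- \<theta>) \<notin> spectrum T"
      "onorm (resolvent T (of_real \<rho> * cis (- \<theta>))) \<le> (1 + \<epsilon> (\<rho> - 1)) / (\<rho> - 1)"
    if "\<theta> \<in> {-\<delta>m..\<delta>p}" "r \<theta> \<le> \<rho>" "\<rho> \<le> r \<delta>p" "1 < \<rho>" for \<rho> \<theta>
  proof -
    have n: "cmod (of_real \<rho> * cis (- \<theta>)) = \<rho>" using that(4) by (simp add: norm_mult)
    then show "of_real \<rho> * cis (- \<theta>) \<notin> spectrum T" using K that(4) by simp
    have "of_real \<rho> * cis (- \<theta>) \<in> v_type_set \<delta>m \<delta>p \<gamma>"
      unfolding v_type_set_def r_def[symmetric] using that by blast
    moreover have "of_real \<rho> * cis (- \<theta>) \<noteq> 1" using n that(4) by auto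
    ultimately show "onorm (resolvent T (of_real \<rho> * cis (- \<theta>))) \<le> (1 + \<epsilon> (\<rho> - 1)) / (\<rho> - 1)"
      using assms(11) n by metis
  qed
  define N where "N \<theta> = onorm (resolvent T (cis (- \<theta>)))" for \<theta>
  \<comment> \<open>the constant covers the angles off the curve, the other summands cover those of the curve\<close>
  define h where "h \<theta> = indicator {-pi..pi} \<theta> * (2 * ((1 + C) * M))
    + indicator {-\<delta>m..\<delta>p} \<theta> * (2 * (1 / (r \<theta> - 1))
        + 4 * (1 + C)\<^sup>2 * L\<^sup>2 * (\<epsilon> (r \<theta> - 1) / (r \<theta> - 1) * (N \<theta>)\<^sup>2))" for \<theta>
  \<comment> \<open>the kernel contains \<open>\<rho> Re \<langle>\<omega> y, x\<rangle>\<close> with \<open>\<rho> \<le> 2\<close>, and subtracts \<open>\<parallel>x\<parallel>\<^sup>2\<close>\<close>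
  define w where "w \<theta> = indicator {-pi..pi} \<theta> + 2 * h \<theta>" for \<theta>
  obtain d0 where d0: "0 < d0" "\<And>x. 0 < x \<Longrightarrow> x < d0 \<Longrightarrow> \<epsilon> x < 1"
    using order_tendstoD(2)[OF assms(10), of 1] unfolding eventually_at_right_field by auto
  \<comment> \<open>if \<open>2 (\<rho> - 1) < b\<close>, the point at doubled distance stays in the region, has \<open>\<epsilon> < 1\<close>, and \<open>\<rho> \<le> 2\<close>\<close>
  define b where "b = min d0 (min L 2)"
  have b: "0 < b" "b \<le> d0" "b \<le> L" "b \<le> 2" using d0 L by (auto simp: b_def)
  have h0: "0 \<le> h \<theta>" for \<theta>
  proof -
    have "0 \<le> 2 * (1 / (r \<theta> - 1)) + 4 * (1 + C)\<^sup>2 * L\<^sup>2 * (\<epsilon> (r \<theta> - 1) / (r \<theta> - 1) * (N \<theta>)\<^sup>2)"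
      if "\<theta> \<in> {-\<delta>m..\<delta>p}"
      using \<epsilon>[OF that] rad(7)[OF that] by (intro add_nonneg_nonneg mult_nonneg_nonneg) auto
    then show ?thesis using M(1) C unfolding h_def
      by (cases "\<theta> \<in> {-\<delta>m..\<delta>p}") simp_all
  qed
  have key: "- (h \<theta> * (norm x)\<^sup>2) \<le> 2 * rinner (cis (- \<theta>) *\<^sub>C y) x"
    if \<theta>: "\<theta> \<in> {-pi..pi}" "\<theta> \<noteq> 0" and \<rho>: "1 < \<rho>" "2 * (\<rho> - 1) < b"
      and x: "x = (of_real \<rho> * cis (- \<theta>)) *\<^sub>C y - T y" for \<theta> \<rho> x y
  proof -
    let ?\<omega> = "cis (- \<theta>)"
    have n: "cmod (of_real \<rho> * ?\<omega>) = \<rho>" using \<rho> by (simp add: norm_mult)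
    have "norm y \<le> C / (\<rho> - 1) * norm x"
      using norm_le_resolvent_bound[of "of_real \<rho> * ?\<omega>" T "C / (\<rho> - 1)" y] K[of "of_real \<rho> * ?\<omega>"] \<rho>(1)
      by (simp add: n x)
    then have y: "norm y \<le> (1 + C) * N \<theta> * norm x"
      unfolding N_def using norm_resolvent_radial[OF _ circle[OF \<theta>] \<rho>(1) x] by simp
    show ?thesis
    proof (cases "\<theta> \<in> {-\<delta>m..\<delta>p}")
      case False
      then have "N \<theta> \<le> M" unfolding N_def using \<theta> by (intro M(2)) (auto simp: A_def)
      then have "(1 + C) * N \<theta> * norm x \<le> (1 + C) * M * norm x"
        using C by (intro mult_right_mono mult_left_mono) auto
      with y have "norm y * norm x \<le> (1 + C) * M * norm x * norm x" by (intro mult_right_mono) auto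
      moreover have "- (norm y * norm x) \<le> rinner (?\<omega> *\<^sub>C y) x"
        using abs_rinner_le_norm[of "?\<omega> *\<^sub>C y" x] by (simp add: norm_scaleC abs_le_iff)
      moreover have "h \<theta> = 2 * ((1 + C) * M)" using False \<theta> by (simp add: h_def)
      moreover have "h \<theta> * (norm x)\<^sup>2 = 2 * ((1 + C) * M * norm x * norm x)"
        using calculation(3) by (simp add: power2_eq_square)
      ultimately show ?thesis by linarith
    next
      case True
      have rt: "1 < r \<theta>" "r \<theta> \<le> r \<delta>p" using rad(6,8)[OF True] \<theta>(2) by auto
      then have en: "0 \<le> \<epsilon> (r \<theta> - 1)" using \<epsilon>[OF True] by (simp add: zero_le_divide_iff)
      have h: "2 / (r \<theta> - 1) + 4 * (1 + C)\<^sup>2 * L\<^sup>2 * (\<epsilon> (r \<theta> - 1) / (r \<theta> - 1) * (N \<theta>)\<^sup>2) \<le> h \<theta>"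
        using True \<theta> C M by (simp add: h_def)
      show ?thesis
      proof (cases "2 * (\<rho> - 1) \<le> r \<theta> - 1")
        case big: True
        have "- (2 / (r \<theta> - 1) * (norm x)\<^sup>2 + 4 * \<epsilon> (r \<theta> - 1) * (r \<theta> - 1) * (norm y)\<^sup>2) \<le> 2 * rinner (?\<omega> *\<^sub>C y) x"
          by (rule rinner_resolvent_from_curve[OF _ \<rho>(1) big en estimate[OF True order_refl rt(2,1)] x]) simp
        moreover have "4 * \<epsilon> (r \<theta> - 1) * (r \<theta> - 1) * (norm y)\<^sup>2
            \<le> 4 * (1 + C)\<^sup>2 * L\<^sup>2 * (\<epsilon> (r \<theta> - 1) / (r \<theta> - 1) * (N \<theta>)\<^sup>2) * (norm x)\<^sup>2"
        proof -
          have "(norm y)\<^sup>2 \<le> ((1 + C) * N \<theta> * norm x)\<^sup>2" using y by (intro power_mono) auto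
          moreover have "(r \<theta> - 1) * (r \<theta> - 1) \<le> L * L"
            using rt by (intro mult_mono) (auto simp: L_def)
          then have "r \<theta> - 1 \<le> L\<^sup>2 / (r \<theta> - 1)" using rt by (simp add: pos_le_divide_eq power2_eq_square)
          ultimately have "(r \<theta> - 1) * (norm y)\<^sup>2 \<le> L\<^sup>2 / (r \<theta> - 1) * ((1 + C) * N \<theta> * norm x)\<^sup>2"
            using rt by (intro mult_mono) auto
          then have "4 * \<epsilon> (r \<theta> - 1) * ((r \<theta> - 1) * (norm y)\<^sup>2)
              \<le> 4 * \<epsilon> (r \<theta> - 1) * (L\<^sup>2 / (r \<theta> - 1) * ((1 + C) * N \<theta> * norm x)\<^sup>2)"
            using en by (intro mult_left_mono) auto
          then show ?thesis by (simp add: power_mult_distrib mult_ac)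
        qed
        moreover have "(2 / (r \<theta> - 1) + 4 * (1 + C)\<^sup>2 * L\<^sup>2 * (\<epsilon> (r \<theta> - 1) / (r \<theta> - 1) * (N \<theta>)\<^sup>2)) * (norm x)\<^sup>2
            \<le> h \<theta> * (norm x)\<^sup>2"
          using h by (intro mult_right_mono) auto
        ultimately show ?thesis unfolding distrib_right by linarith
      next
        case small: False
        define d where "d = \<rho> - 1"
        have d: "0 < d" "2 * d < b" "1 + d = \<rho>" "r \<theta> < 1 + 2 * d" using \<rho> small by (auto simp: d_def)
        have est: "of_real (1 + 2 * d) * ?\<omega> \<notin> spectrum T"
          "onorm (resolvent T (of_real (1 + 2 * d) * ?\<omega>)) \<le> (1 + \<epsilon> (2 * d)) / (2 * d)"
          using estimate[OF True, of "1 + 2 * d"] d b by (auto simp: L_def)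
        have "2 * d \<in> {0<..\<nu>}" using d b assms(6) by (auto simp: L_def)
        then have e: "0 \<le> \<epsilon> (2 * d)" "\<epsilon> (2 * d) \<le> 1"
          using assms(9) d0(2)[of "2 * d"] d b by (auto intro: less_imp_le)
        have "- ((norm x)\<^sup>2 / d) \<le> 2 * rinner (?\<omega> *\<^sub>C y) x"
          by (rule rinner_resolvent_doubled_distance[OF _ d(1) e est]) (simp_all add: x d(3))
        moreover have "(norm x)\<^sup>2 / d \<le> h \<theta> * (norm x)\<^sup>2"
        proof -
          have "0 \<le> 4 * (1 + C)\<^sup>2 * L\<^sup>2 * (\<epsilon> (r \<theta> - 1) / (r \<theta> - 1) * (N \<theta>)\<^sup>2)"
            by (intro mult_nonneg_nonneg \<epsilon>[OF True]) auto
          then have "2 / (r \<theta> - 1) \<le> h \<theta>" using h by linarith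
          moreover have "1 / d \<le> 2 / (r \<theta> - 1)" using rt d by (simp add: field_simps)
          ultimately have "1 / d \<le> h \<theta>" by linarith
          from mult_right_mono[OF this, of "(norm x)\<^sup>2"] show ?thesis by simp
        qed
        ultimately show ?thesis by linarith
      qed
    qed
  qed
  show ?thesis
  proof (rule similar_to_contraction_if_poisson_bounded_below)
    have i1: "integrable lborel (\<lambda>\<theta>. indicator {-pi..pi} \<theta> * c)" for c :: real by simp
    have i2: "integrable lborel (\<lambda>\<theta>. indicator {-\<delta>m..\<delta>p} \<theta> * (1 / (r \<theta> - 1)))"
      using rad(9) by (simp add: set_integrable_def)
    have i3: "integrable lborel (\<lambda>\<theta>. indicator {-\<delta>m..\<delta>p} \<theta> * (\<epsilon> (r \<theta> - 1) / (r \<theta> - 1) * (N \<theta>)\<^sup>2))"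
      using assms(12) by (simp add: set_integrable_def N_def)
    have w_eq: "w = (\<lambda>\<theta>. indicator {-pi..pi} \<theta> * (1 + 4 * ((1 + C) * M))
        + (4 * (indicator {-\<delta>m..\<delta>p} \<theta> * (1 / (r \<theta> - 1)))
        + 8 * (1 + C)\<^sup>2 * L\<^sup>2 * (indicator {-\<delta>m..\<delta>p} \<theta> * (\<epsilon> (r \<theta> - 1) / (r \<theta> - 1) * (N \<theta>)\<^sup>2))))"
      by (auto simp: w_def h_def fun_eq_iff indicator_def)
    show "integrable lborel w"
      unfolding w_eq by (intro Bochner_Integration.integrable_add integrable_mult_right i1 i2 i3)
    show "0 \<le> w \<theta>" for \<theta> using h0[of \<theta>] by (simp add: w_def)
    show "1 / (1 + b / 2) < 1" using b by simp
    fix s \<theta> x assume s: "1 / (1 + b / 2) < s" "0 < s" "s < 1" and \<theta>: "\<theta> \<in> {-pi..pi}" "\<theta> \<noteq> 0"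
    define \<rho> where "\<rho> = 1 / s"
    have \<rho>: "1 < \<rho>" "2 * (\<rho> - 1) < b" "\<rho> \<le> 2"
    proof -
      show "1 < \<rho>" using s by (simp add: \<rho>_def)
      show "2 * (\<rho> - 1) < b" using s b by (simp add: \<rho>_def field_simps)
      then show "\<rho> \<le> 2" using b by (simp add: right_diff_distrib)
    qed
    define y where "y = resolvent T (of_real \<rho> * cis (- \<theta>)) x"
    have inv: "1 / (of_real s * cis \<theta>) = of_real \<rho> * cis (- \<theta>)"
      by (simp add: \<rho>_def divide_inverse)
    have Q: "reciprocal_resolvent T (of_real s * cis \<theta>) x = \<rho> *\<^sub>R (cis (- \<theta>) *\<^sub>C y)"
      using s unfolding reciprocal_resolvent_def inv
      by (simp add: y_def scaleC_of_real[symmetric] scaleC_scaleC)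
    have "x = (of_real \<rho> * cis (- \<theta>)) *\<^sub>C y - T y"
      using resolvent_inverse(3)[of "of_real \<rho> * cis (- \<theta>)" T x] K[of "of_real \<rho> * cis (- \<theta>)"] \<rho>(1)
      by (simp add: y_def norm_mult)
    from mult_left_mono[OF key[OF \<theta> \<rho>(1,2) this], of \<rho>] \<rho>(1)
    have "- (\<rho> * (h \<theta> * (norm x)\<^sup>2)) \<le> 2 * (\<rho> * rinner (cis (- \<theta>) *\<^sub>C y) x)" by (simp add: mult_ac)
    moreover have "\<rho> * (h \<theta> * (norm x)\<^sup>2) \<le> 2 * (h \<theta> * (norm x)\<^sup>2)"
      using \<rho>(3) h0 by (intro mult_right_mono) auto
    moreover have "w \<theta> * (norm x)\<^sup>2 = (norm x)\<^sup>2 + 2 * (h \<theta> * (norm x)\<^sup>2)"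
      using \<theta> by (simp add: w_def algebra_simps)
    ultimately show "(norm x)\<^sup>2 \<le> 2 * rinner (reciprocal_resolvent T (of_real s * cis \<theta>) x) x + w \<theta> * (norm x)\<^sup>2"
      unfolding Q rinner_scaleR_left by linarith
  qed
qed

end
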